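(* Let $L\colon\mathscr A\leftrightarrows\mathscr B:R$ be a Quillen equivalence (with $L$ left adjoint) between simplicial model categories. Suppose there exist left Bousfield localizations $\mathcal F_{\mathscr A}^{-1}\mathscr A$ of $\mathscr A$ and $\mathcal F_{\mathscr B}^{-1}\mathscr B$ of $\mathscr B$ such that: (1) $R$ takes $\mathcal F_{\mathscr B}$-local objects to $\mathcal F_{\mathscr A}$-local objects; (2) $L$ commutes with the localization, i.e. for all cofibrant $A\in\mathscr A$ the map $L\mathcal F_{\mathscr A}^{-1}(A)\to\mathcal F_{\mathscr B}^{-1}(LA)$ is a weak equivalence in $\mathscr B$, where this map is the adjoint of a lift $\mathcal F_{\mathscr A}^{-1}(A)\to R\mathcal F_{\mathscr B}^{-1}(LA)$, in $\mathcal F_{\mathscr A}^{-1}\mathscr A$, of the composite $A\to RLA\to R\mathcal F_{\mathscr B}^{-1}(LA)$ along the trivial cofibration $A\to\mathcal F_{\mathscr A}^{-1}(A)$ of $\mathcal F_{\mathscr A}^{-1}\mathscr A$ (the lift existing since $R\mathcal F_{\mathscr B}^{-1}(LA)$ is fibrant in $\mathcal F_{\mathscr A}^{-1}\mathscr A$). Then the same adjunction gives a Quillen equivalence of the localized model categories $$L\colon\mathcal F_{\mathscr A}^{-1}\mathscr A\leftrightarrows\mathcal F_{\mathscr B}^{-1}\mathscr B:R.$$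
   Context: All model categories and functors are simplicial. For a model category $\mathscr A$ equipped with a homotopy localization functor $\mathcal F_{\mathscr A}^{-1}\colon\mathscr A\to\mathscr A$, the left Bousfield localization of $\mathscr A$ with respect to the $\mathcal F_{\mathscr A}^{-1}$-equivalences (maps sent by $\mathcal F_{\mathscr A}^{-1}$ to weak equivalences), also called $\mathcal F_{\mathscr A}$-local equivalences, is denoted $\mathcal F_{\mathscr A}^{-1}\mathscr A$: it has the same cofibrations as $\mathscr A$ and these equivalences as weak equivalences. For $A\in\mathscr A$, $\mathcal F_{\mathscr A}^{-1}(A)$ denotes the fibrant replacement of $A$ in $\mathcal F_{\mathscr A}^{-1}\mathscr A$, with $A\to\mathcal F_{\mathscr A}^{-1}(A)$ a trivial cofibration in $\mathcal F_{\mathscr A}^{-1}\mathscr A$. The $\mathcal F_{\mathscr A}$-local objects are the fibrant objects of $\mathcal F_{\mathscr A}^{-1}\mathscr A$. Similarly for $\mathscr B$. In (2), $A\to RLA$ is the unit of the adjunction and $RLA\to R\mathcal F_{\mathscr B}^{-1}(LA)$ is $R$ applied to the fibrant replacement map of $LA$ in $\mathcal F_{\mathscr B}^{-1}\mathscr B$. *)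

theory Defs
  imports "HOL-Library.FuncSet" "HOL-Library.Infinite_Typeclass"
begin

section \<open>Categories, limits and colimits\<close>

record ('o, 'a) cat =
  Obj :: "'o set"
  Arr :: "'a set"
  Dom :: "'a \<Rightarrow> 'o"
  Cod :: "'a \<Rightarrow> 'o"
  Id :: "'o \<Rightarrow> 'a"
  Comp :: "'a \<Rightarrow> 'a \<Rightarrow> 'a"  (infixl "\<cdot>\<index>" 70)

definition hom :: "('o, 'a, 'z) cat_scheme \<Rightarrow> 'o \<Rightarrow> 'o \<Rightarrow> 'a set" where
  "hom C X Y = {f \<in> Arr C. Dom C f = X \<and> Cod C f = Y}"

locale category =
  fixes C :: "('o, 'a, 'z) cat_scheme" (structure)
  assumes dom_cod: "f \<in> Arr C \<Longrightarrow> Dom C f \<in> Obj C \<and> Cod C f \<in> Obj C"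
    and id_hom: "X \<in> Obj C \<Longrightarrow> Id C X \<in> hom C X X"
    and comp_hom: "\<lbrakk>f \<in> hom C X Y; g \<in> hom C Y Z\<rbrakk> \<Longrightarrow> g \<cdot> f \<in> hom C X Z"
    and comp_id_right: "f \<in> hom C X Y \<Longrightarrow> f \<cdot> Id C X = f"
    and comp_id_left: "f \<in> hom C X Y \<Longrightarrow> Id C Y \<cdot> f = f"
    and comp_assoc: "\<lbrakk>f \<in> hom C W X; g \<in> hom C X Y; h \<in> hom C Y Z\<rbrakk>
      \<Longrightarrow> h \<cdot> (g \<cdot> f) = (h \<cdot> g) \<cdot> f"

definition is_functor ::
  "('o, 'a, 'z) cat_scheme \<Rightarrow> ('p, 'b, 'y) cat_scheme \<Rightarrow> ('o \<Rightarrow> 'p) \<Rightarrow> ('a \<Rightarrow> 'b) \<Rightarrow> bool" where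
  "is_functor C D Fo Fa \<longleftrightarrow>
     (\<forall>X \<in> Obj C. Fo X \<in> Obj D \<and> Fa (Id C X) = Id D (Fo X)) \<and>
     (\<forall>X Y. \<forall>f \<in> hom C X Y. Fa f \<in> hom D (Fo X) (Fo Y)) \<and>
     (\<forall>X Y Z. \<forall>f \<in> hom C X Y. \<forall>g \<in> hom C Y Z. Fa (g \<cdot>\<^bsub>C\<^esub> f) = Fa g \<cdot>\<^bsub>D\<^esub> Fa f)"

definition is_cone ::
  "('i, 'j, 'y) cat_scheme \<Rightarrow> ('o, 'a, 'z) cat_scheme \<Rightarrow> ('i \<Rightarrow> 'o) \<Rightarrow> ('j \<Rightarrow> 'a)
    \<Rightarrow> 'o \<Rightarrow> ('i \<Rightarrow> 'a) \<Rightarrow> bool" where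
  "is_cone J C Do Da c \<pi> \<longleftrightarrow> c \<in> Obj C \<and>
     (\<forall>j \<in> Obj J. \<pi> j \<in> hom C c (Do j)) \<and>
     (\<forall>\<alpha> \<in> Arr J. Da \<alpha> \<cdot>\<^bsub>C\<^esub> \<pi> (Dom J \<alpha>) = \<pi> (Cod J \<alpha>))"

definition is_limit ::
  "('i, 'j, 'y) cat_scheme \<Rightarrow> ('o, 'a, 'z) cat_scheme \<Rightarrow> ('i \<Rightarrow> 'o) \<Rightarrow> ('j \<Rightarrow> 'a)
    \<Rightarrow> 'o \<Rightarrow> ('i \<Rightarrow> 'a) \<Rightarrow> bool" where
  "is_limit J C Do Da c \<pi> \<longleftrightarrow> is_cone J C Do Da c \<pi> \<and>
     (\<forall>d \<rho>. is_cone J C Do Da d \<rho> \<longrightarrow>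
        (\<exists>!u. u \<in> hom C d c \<and> (\<forall>j \<in> Obj J. \<pi> j \<cdot>\<^bsub>C\<^esub> u = \<rho> j)))"

definition is_cocone ::
  "('i, 'j, 'y) cat_scheme \<Rightarrow> ('o, 'a, 'z) cat_scheme \<Rightarrow> ('i \<Rightarrow> 'o) \<Rightarrow> ('j \<Rightarrow> 'a)
    \<Rightarrow> 'o \<Rightarrow> ('i \<Rightarrow> 'a) \<Rightarrow> bool" where
  "is_cocone J C Do Da c \<iota> \<longleftrightarrow> c \<in> Obj C \<and>
     (\<forall>j \<in> Obj J. \<iota> j \<in> hom C (Do j) c) \<and>
     (\<forall>\<alpha> \<in> Arr J. \<iota> (Cod J \<alpha>) \<cdot>\<^bsub>C\<^esub> Da \<alpha> = \<iota> (Dom J \<alpha>))"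

definition is_colimit ::
  "('i, 'j, 'y) cat_scheme \<Rightarrow> ('o, 'a, 'z) cat_scheme \<Rightarrow> ('i \<Rightarrow> 'o) \<Rightarrow> ('j \<Rightarrow> 'a)
    \<Rightarrow> 'o \<Rightarrow> ('i \<Rightarrow> 'a) \<Rightarrow> bool" where
  "is_colimit J C Do Da c \<iota> \<longleftrightarrow> is_cocone J C Do Da c \<iota> \<and>
     (\<forall>d \<rho>. is_cocone J C Do Da d \<rho> \<longrightarrow>
        (\<exists>!u. u \<in> hom C c d \<and> (\<forall>j \<in> Obj J. u \<cdot>\<^bsub>C\<^esub> \<iota> j = \<rho> j)))"

text \<open>
  An infinite type \<open>'s\<close> fixes what ``small'' means: a set is small if it can be
  realised inside \<open>'s\<close>. Small diagrams are indexed by categories whose objects and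
  arrows lie in \<open>'s\<close> (in particular all finite diagrams are small), and small
  simplicial sets have their simplices in \<open>'s\<close>. Nothing bounds the size of the
  categories themselves.
\<close>

definition small_complete :: "'s itself \<Rightarrow> ('o, 'a, 'z) cat_scheme \<Rightarrow> bool" where
  "small_complete small C \<longleftrightarrow>
     (\<forall>(J :: ('s, 's) cat) Do Da. category J \<and> is_functor J C Do Da \<longrightarrow>
        (\<exists>c \<pi>. is_limit J C Do Da c \<pi>))"

definition small_cocomplete :: "'s itself \<Rightarrow> ('o, 'a, 'z) cat_scheme \<Rightarrow> bool" where
  "small_cocomplete small C \<longleftrightarrow>
     (\<forall>(J :: ('s, 's) cat) Do Da. category J \<and> is_functor J C Do Da \<longrightarrow>
        (\<exists>c \<iota>. is_colimit J C Do Da c \<iota>))"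

definition is_terminal :: "('o, 'a, 'z) cat_scheme \<Rightarrow> 'o \<Rightarrow> bool" where
  "is_terminal C T \<longleftrightarrow> T \<in> Obj C \<and> (\<forall>X \<in> Obj C. \<exists>!f. f \<in> hom C X T)"

definition is_initial :: "('o, 'a, 'z) cat_scheme \<Rightarrow> 'o \<Rightarrow> bool" where
  "is_initial C I \<longleftrightarrow> I \<in> Obj C \<and> (\<forall>X \<in> Obj C. \<exists>!f. f \<in> hom C I X)"

definition is_retract :: "('o, 'a, 'z) cat_scheme \<Rightarrow> 'a \<Rightarrow> 'a \<Rightarrow> bool" where
  "is_retract C f g \<longleftrightarrow> f \<in> Arr C \<and> g \<in> Arr C \<and>
     (\<exists>i \<in> hom C (Dom C f) (Dom C g). \<exists>r \<in> hom C (Dom C g) (Dom C f).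
      \<exists>j \<in> hom C (Cod C f) (Cod C g). \<exists>s \<in> hom C (Cod C g) (Cod C f).
        r \<cdot>\<^bsub>C\<^esub> i = Id C (Dom C f) \<and> s \<cdot>\<^bsub>C\<^esub> j = Id C (Cod C f) \<and>
        g \<cdot>\<^bsub>C\<^esub> i = j \<cdot>\<^bsub>C\<^esub> f \<and> f \<cdot>\<^bsub>C\<^esub> r = s \<cdot>\<^bsub>C\<^esub> g)"

definition lifts_against :: "('o, 'a, 'z) cat_scheme \<Rightarrow> 'a \<Rightarrow> 'a \<Rightarrow> bool" where
  "lifts_against C i p \<longleftrightarrow>
     (\<forall>u \<in> hom C (Dom C i) (Dom C p). \<forall>v \<in> hom C (Cod C i) (Cod C p).
        p \<cdot>\<^bsub>C\<^esub> u = v \<cdot>\<^bsub>C\<^esub> i \<longrightarrow>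
        (\<exists>h \<in> hom C (Cod C i) (Dom C p). h \<cdot>\<^bsub>C\<^esub> i = u \<and> p \<cdot>\<^bsub>C\<^esub> h = v))"


section \<open>Simplicial sets\<close>

text \<open>
  A morphism from \<open>[m]\<close> to \<open>[n]\<close> of the simplex category is a monotone map from
  \<open>{..m}\<close> to \<open>{..n}\<close>, made extensional so that equality of functions is equality
  of morphisms.
\<close>

definition Delta :: "nat \<Rightarrow> nat \<Rightarrow> (nat \<Rightarrow> nat) set" where
  "Delta m n = {\<theta> \<in> {..m} \<rightarrow>\<^sub>E {..n}. mono_on {..m} \<theta>}"

record 'x sset =
  Simp :: "nat \<Rightarrow> 'x set"
  Act :: "nat \<Rightarrow> nat \<Rightarrow> (nat \<Rightarrow> nat) \<Rightarrow> 'x \<Rightarrow> 'x"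
    \<comment> \<open>\<open>Act K m n \<theta>\<close> maps \<open>n\<close>-simplices to \<open>m\<close>-simplices, for \<open>\<theta> \<in> Delta m n\<close>\<close>

locale simplicial_set =
  fixes K :: "'x sset"
  assumes act_closed: "\<lbrakk>\<theta> \<in> Delta m n; x \<in> Simp K n\<rbrakk> \<Longrightarrow> Act K m n \<theta> x \<in> Simp K m"
    and act_id: "x \<in> Simp K n \<Longrightarrow> Act K n n (restrict id {..n}) x = x"
    and act_comp: "\<lbrakk>\<theta> \<in> Delta m n; \<phi> \<in> Delta l m; x \<in> Simp K n\<rbrakk>
      \<Longrightarrow> Act K l m \<phi> (Act K m n \<theta> x) = Act K l n (compose {..l} \<theta> \<phi>) x"

definition simplicial_map :: "'x sset \<Rightarrow> 'y sset \<Rightarrow> (nat \<Rightarrow> 'x \<Rightarrow> 'y) \<Rightarrow> bool" where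
  "simplicial_map K L f \<longleftrightarrow>
     (\<forall>n. \<forall>x \<in> Simp K n. f n x \<in> Simp L n) \<and>
     (\<forall>m n. \<forall>\<theta> \<in> Delta m n. \<forall>x \<in> Simp K n.
        f m (Act K m n \<theta> x) = Act L m n \<theta> (f n x))"

definition sset_hom :: "'x sset \<Rightarrow> 'y sset \<Rightarrow> (nat \<Rightarrow> 'x \<Rightarrow> 'y) set" where
  "sset_hom K L = {f. simplicial_map K L f \<and> (\<forall>n. f n \<in> extensional (Simp K n))}"

definition sset_prod :: "'x sset \<Rightarrow> 'y sset \<Rightarrow> ('x \<times> 'y) sset" where
  "sset_prod K L = \<lparr>Simp = (\<lambda>n. Simp K n \<times> Simp L n),
     Act = (\<lambda>m n \<theta> (x, y). (Act K m n \<theta> x, Act L m n \<theta> y))\<rparr>"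

definition std_simplex :: "nat \<Rightarrow> (nat \<Rightarrow> nat) sset" where
  "std_simplex n = \<lparr>Simp = (\<lambda>m. Delta m n), Act = (\<lambda>l m \<phi> \<theta>. compose {..l} \<theta> \<phi>)\<rparr>"

definition boundary :: "nat \<Rightarrow> (nat \<Rightarrow> nat) sset" where
  "boundary n = (std_simplex n)
     \<lparr>Simp := (\<lambda>m. {\<theta> \<in> Delta m n. \<theta> ` {..m} \<noteq> {..n}})\<rparr>"

definition horn :: "nat \<Rightarrow> nat \<Rightarrow> (nat \<Rightarrow> nat) sset" where
  "horn n k = (std_simplex n)
     \<lparr>Simp := (\<lambda>m. {\<theta> \<in> Delta m n. insert k (\<theta> ` {..m}) \<noteq> {..n}})\<rparr>"

text \<open>Right lifting property of \<open>p : K \<rightarrow> L\<close> against the inclusion of a subcomplex \<open>S\<close> of \<open>T\<close>.\<close>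

definition sset_rlp ::
  "'x sset \<Rightarrow> 'y sset \<Rightarrow> (nat \<Rightarrow> 'x \<Rightarrow> 'y) \<Rightarrow> 't sset \<Rightarrow> 't sset \<Rightarrow> bool" where
  "sset_rlp K L p S T \<longleftrightarrow>
     (\<forall>a \<in> sset_hom S K. \<forall>b \<in> sset_hom T L.
        (\<forall>m. \<forall>t \<in> Simp S m. p m (a m t) = b m t) \<longrightarrow>
        (\<exists>h \<in> sset_hom T K. (\<forall>m. \<forall>t \<in> Simp S m. h m t = a m t) \<and>
                           (\<forall>m. \<forall>t \<in> Simp T m. p m (h m t) = b m t)))"

definition kan_fibration :: "'x sset \<Rightarrow> 'y sset \<Rightarrow> (nat \<Rightarrow> 'x \<Rightarrow> 'y) \<Rightarrow> bool" where
  "kan_fibration K L p \<longleftrightarrow> simplicial_map K L p \<and>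
     (\<forall>n k. 1 \<le> n \<and> k \<le> n \<longrightarrow> sset_rlp K L p (horn n k) (std_simplex n))"

definition trivial_kan_fibration :: "'x sset \<Rightarrow> 'y sset \<Rightarrow> (nat \<Rightarrow> 'x \<Rightarrow> 'y) \<Rightarrow> bool" where
  "trivial_kan_fibration K L p \<longleftrightarrow> simplicial_map K L p \<and>
     (\<forall>n. sset_rlp K L p (boundary n) (std_simplex n))"


section \<open>Simplicial categories\<close>

text \<open>
  \<open>sMap C X Y\<close> is the mapping space, \<open>sComp C X Y Z n\<close> composition of its \<open>n\<close>-simplices,
  and \<open>Vtx C\<close> identifies arrows with vertices of mapping spaces.
\<close>

record ('o, 'a, 'x) scat = "('o, 'a) cat" +
  sMap :: "'o \<Rightarrow> 'o \<Rightarrow> 'x sset"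
  sComp :: "'o \<Rightarrow> 'o \<Rightarrow> 'o \<Rightarrow> nat \<Rightarrow> 'x \<Rightarrow> 'x \<Rightarrow> 'x"
  Vtx :: "'a \<Rightarrow> 'x"

text \<open>The totally degenerate \<open>n\<close>-simplex on an arrow.\<close>

definition arr_simplex :: "('o, 'a, 'x, 'z) scat_scheme \<Rightarrow> nat \<Rightarrow> 'a \<Rightarrow> 'x" where
  "arr_simplex C n f = Act (sMap C (Dom C f) (Cod C f)) n 0 (\<lambda>i\<in>{..n}. 0) (Vtx C f)"

locale simplicial_category = category C
  for C :: "('o, 'a, 'x, 'z) scat_scheme" (structure) +
  assumes map_sset: "\<lbrakk>X \<in> Obj C; Y \<in> Obj C\<rbrakk> \<Longrightarrow> simplicial_set (sMap C X Y)"
    and scomp_map: "\<lbrakk>X \<in> Obj C; Y \<in> Obj C; Z \<in> Obj C\<rbrakk> \<Longrightarrow>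
      simplicial_map (sset_prod (sMap C Y Z) (sMap C X Y)) (sMap C X Z)
        (\<lambda>n (g, f). sComp C X Y Z n g f)"
    and scomp_assoc: "\<lbrakk>W \<in> Obj C; X \<in> Obj C; Y \<in> Obj C; Z \<in> Obj C;
        f \<in> Simp (sMap C W X) n; g \<in> Simp (sMap C X Y) n; h \<in> Simp (sMap C Y Z) n\<rbrakk> \<Longrightarrow>
      sComp C W Y Z n h (sComp C W X Y n g f) = sComp C W X Z n (sComp C X Y Z n h g) f"
    and scomp_id_right: "\<lbrakk>X \<in> Obj C; Y \<in> Obj C; f \<in> Simp (sMap C X Y) n\<rbrakk> \<Longrightarrow>
      sComp C X X Y n f (arr_simplex C n (Id C X)) = f"
    and scomp_id_left: "\<lbrakk>X \<in> Obj C; Y \<in> Obj C; f \<in> Simp (sMap C X Y) n\<rbrakk> \<Longrightarrow>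
      sComp C X Y Y n (arr_simplex C n (Id C Y)) f = f"
    and vtx_bij: "\<lbrakk>X \<in> Obj C; Y \<in> Obj C\<rbrakk> \<Longrightarrow>
      bij_betw (Vtx C) (hom C X Y) (Simp (sMap C X Y) 0)"
    and vtx_comp: "\<lbrakk>a \<in> hom C X Y; b \<in> hom C Y Z\<rbrakk> \<Longrightarrow>
      Vtx C (b \<cdot> a) = sComp C X Y Z 0 (Vtx C b) (Vtx C a)"

text \<open>
  \<open>T\<close> is the tensor of \<open>X\<close> with \<open>K\<close> if some simplicial map \<open>u : K \<rightarrow> Map(X, T)\<close> induces, for
  every \<open>Y\<close>, an isomorphism from \<open>Map(T, Y)\<close> to \<open>Map(K, Map(X, Y))\<close>, the simplicial set whose
  \<open>n\<close>-simplices are the simplicial maps from \<open>K \<times> \<Delta>[n]\<close> to \<open>Map(X, Y)\<close>. By the enriched Yoneda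
  lemma this is the same as a simplicially natural isomorphism of these functors of \<open>Y\<close>.
  Cotensors are dual.
\<close>

definition is_tensor ::
  "('o, 'a, 'x, 'z) scat_scheme \<Rightarrow> 'o \<Rightarrow> 'k sset \<Rightarrow> 'o \<Rightarrow> bool" where
  "is_tensor C X K T \<longleftrightarrow> T \<in> Obj C \<and>
     (\<exists>u. simplicial_map K (sMap C X T) u \<and>
       (\<forall>Y \<in> Obj C. \<forall>n. bij_betw
          (\<lambda>g m. \<lambda>(k, \<theta>) \<in> Simp K m \<times> Delta m n.
              sComp C X T Y m (Act (sMap C T Y) m n \<theta> g) (u m k))
          (Simp (sMap C T Y) n)
          (sset_hom (sset_prod K (std_simplex n)) (sMap C X Y))))"

definition is_cotensor ::
  "('o, 'a, 'x, 'z) scat_scheme \<Rightarrow> 'o \<Rightarrow> 'k sset \<Rightarrow> 'o \<Rightarrow> bool" where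
  "is_cotensor C Y K T \<longleftrightarrow> T \<in> Obj C \<and>
     (\<exists>u. simplicial_map K (sMap C T Y) u \<and>
       (\<forall>X \<in> Obj C. \<forall>n. bij_betw
          (\<lambda>g m. \<lambda>(k, \<theta>) \<in> Simp K m \<times> Delta m n.
              sComp C X T Y m (u m k) (Act (sMap C X T) m n \<theta> g))
          (Simp (sMap C X T) n)
          (sset_hom (sset_prod K (std_simplex n)) (sMap C X Y))))"


section \<open>Simplicial model categories\<close>

record ('o, 'a, 'x) smcat = "('o, 'a, 'x) scat" +
  WE :: "'a set"
  Cof :: "'a set"
  Fib :: "'a set"

locale model_category = category M
  for small :: "'s::infinite itself" and M :: "('o, 'a, 'x, 'z) smcat_scheme" (structure) +
  assumes classes_arr: "WE M \<subseteq> Arr M" "Cof M \<subseteq> Arr M" "Fib M \<subseteq> Arr M"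
    and complete: "small_complete small M"
    and cocomplete: "small_cocomplete small M"
    and two_of_three: "\<lbrakk>f \<in> hom M X Y; g \<in> hom M Y Z\<rbrakk> \<Longrightarrow>
      (f \<in> WE M \<and> g \<in> WE M \<longrightarrow> g \<cdot> f \<in> WE M) \<and>
      (f \<in> WE M \<and> g \<cdot> f \<in> WE M \<longrightarrow> g \<in> WE M) \<and>
      (g \<in> WE M \<and> g \<cdot> f \<in> WE M \<longrightarrow> f \<in> WE M)"
    and retracts: "is_retract M f g \<Longrightarrow>
      (g \<in> WE M \<longrightarrow> f \<in> WE M) \<and> (g \<in> Cof M \<longrightarrow> f \<in> Cof M) \<and> (g \<in> Fib M \<longrightarrow> f \<in> Fib M)"
    and lifting: "\<lbrakk>i \<in> Cof M; p \<in> Fib M; i \<in> WE M \<or> p \<in> WE M\<rbrakk> \<Longrightarrow> lifts_against M i p"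
    and factor_cof_trivfib: "f \<in> hom M X Y \<Longrightarrow>
      \<exists>Z. \<exists>i \<in> hom M X Z. \<exists>p \<in> hom M Z Y. i \<in> Cof M \<and> p \<in> Fib M \<inter> WE M \<and> f = p \<cdot> i"
    and factor_trivcof_fib: "f \<in> hom M X Y \<Longrightarrow>
      \<exists>Z. \<exists>i \<in> hom M X Z. \<exists>p \<in> hom M Z Y. i \<in> Cof M \<inter> WE M \<and> p \<in> Fib M \<and> f = p \<cdot> i"

text \<open>
  For \<open>i : A \<rightarrow> B\<close> and \<open>p : X \<rightarrow> Y\<close>, the fibre product of \<open>Map(A, X)\<close> and \<open>Map(B, Y)\<close> over
  \<open>Map(A, Y)\<close>, and the map to it from \<open>Map(B, X)\<close>.
\<close>

definition corner_sset :: "('o, 'a, 'x, 'z) scat_scheme \<Rightarrow> 'a \<Rightarrow> 'a \<Rightarrow> ('x \<times> 'x) sset" where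
  "corner_sset M i p =
     (let A = Dom M i; B = Cod M i; X = Dom M p; Y = Cod M p in
      (sset_prod (sMap M A X) (sMap M B Y))
        \<lparr>Simp := (\<lambda>n. {(a, b). a \<in> Simp (sMap M A X) n \<and> b \<in> Simp (sMap M B Y) n \<and>
           sComp M A X Y n (arr_simplex M n p) a = sComp M A B Y n b (arr_simplex M n i)})\<rparr>)"

definition corner_map ::
  "('o, 'a, 'x, 'z) scat_scheme \<Rightarrow> 'a \<Rightarrow> 'a \<Rightarrow> nat \<Rightarrow> 'x \<Rightarrow> 'x \<times> 'x" where
  "corner_map M i p n g =
     (let A = Dom M i; B = Cod M i; X = Dom M p; Y = Cod M p in
      (sComp M A B X n g (arr_simplex M n i), sComp M B X Y n (arr_simplex M n p) g))"

locale simplicial_model_category = model_category small M + simplicial_category M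
  for small :: "'s::infinite itself" and M :: "('o, 'a, 'x, 'z) smcat_scheme" (structure) +
  assumes tensors: "\<And>X (K :: 's sset). \<lbrakk>X \<in> Obj M; simplicial_set K\<rbrakk> \<Longrightarrow> \<exists>T. is_tensor M X K T"
    and cotensors: "\<And>Y (K :: 's sset). \<lbrakk>Y \<in> Obj M; simplicial_set K\<rbrakk> \<Longrightarrow> \<exists>T. is_cotensor M Y K T"
    and corner_fibration: "\<lbrakk>i \<in> Cof M; p \<in> Fib M\<rbrakk> \<Longrightarrow>
      kan_fibration (sMap M (Cod M i) (Dom M p)) (corner_sset M i p) (corner_map M i p)"
    and corner_trivial_fibration: "\<lbrakk>i \<in> Cof M; p \<in> Fib M; i \<in> WE M \<or> p \<in> WE M\<rbrakk> \<Longrightarrow>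
      trivial_kan_fibration (sMap M (Cod M i) (Dom M p)) (corner_sset M i p) (corner_map M i p)"

definition fibrant :: "('o, 'a, 'x, 'z) smcat_scheme \<Rightarrow> 'o \<Rightarrow> bool" where
  "fibrant M X \<longleftrightarrow> X \<in> Obj M \<and> (\<exists>T. is_terminal M T \<and> (\<exists>f \<in> hom M X T. f \<in> Fib M))"

definition cofibrant :: "('o, 'a, 'x, 'z) smcat_scheme \<Rightarrow> 'o \<Rightarrow> bool" where
  "cofibrant M X \<longleftrightarrow> X \<in> Obj M \<and> (\<exists>I. is_initial M I \<and> (\<exists>f \<in> hom M I X. f \<in> Cof M))"


section \<open>Simplicial functors and Quillen equivalences\<close>

record ('o, 'a, 'x, 'p, 'b, 'y) sfun =
  onObj :: "'o \<Rightarrow> 'p"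
  onArr :: "'a \<Rightarrow> 'b"
  onMap :: "'o \<Rightarrow> 'o \<Rightarrow> nat \<Rightarrow> 'x \<Rightarrow> 'y"

definition simplicial_functor ::
  "('o, 'a, 'x, 'z) scat_scheme \<Rightarrow> ('p, 'b, 'y, 'w) scat_scheme
    \<Rightarrow> ('o, 'a, 'x, 'p, 'b, 'y) sfun \<Rightarrow> bool" where
  "simplicial_functor C D F \<longleftrightarrow>
     is_functor C D (onObj F) (onArr F) \<and>
     (\<forall>X \<in> Obj C. \<forall>Y \<in> Obj C.
        simplicial_map (sMap C X Y) (sMap D (onObj F X) (onObj F Y)) (onMap F X Y)) \<and>
     (\<forall>X \<in> Obj C. \<forall>Y \<in> Obj C. \<forall>f \<in> hom C X Y.
        onMap F X Y 0 (Vtx C f) = Vtx D (onArr F f)) \<and>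
     (\<forall>X \<in> Obj C. \<forall>Y \<in> Obj C. \<forall>Z \<in> Obj C. \<forall>n.
        \<forall>f \<in> Simp (sMap C X Y) n. \<forall>g \<in> Simp (sMap C Y Z) n.
          onMap F X Z n (sComp C X Y Z n g f) =
          sComp D (onObj F X) (onObj F Y) (onObj F Z) n (onMap F Y Z n g) (onMap F X Y n f))"

definition sfun_id :: "('o, 'a, 'x, 'o, 'a, 'x) sfun" where
  "sfun_id = \<lparr>onObj = (\<lambda>X. X), onArr = (\<lambda>f. f), onMap = (\<lambda>X Y n x. x)\<rparr>"

definition sfun_comp ::
  "('p, 'b, 'y, 'q, 'c, 'w) sfun \<Rightarrow> ('o, 'a, 'x, 'p, 'b, 'y) sfun
    \<Rightarrow> ('o, 'a, 'x, 'q, 'c, 'w) sfun" where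
  "sfun_comp G F = \<lparr>onObj = (\<lambda>X. onObj G (onObj F X)), onArr = (\<lambda>f. onArr G (onArr F f)),
     onMap = (\<lambda>X Y n x. onMap G (onObj F X) (onObj F Y) n (onMap F X Y n x))\<rparr>"

text \<open>In simplicial degree \<open>0\<close> the second clause says that \<open>\<alpha>\<close> is natural in the ordinary sense.\<close>

definition simplicial_nat_trans ::
  "('o, 'a, 'x, 'z) scat_scheme \<Rightarrow> ('p, 'b, 'y, 'w) scat_scheme
    \<Rightarrow> ('o, 'a, 'x, 'p, 'b, 'y) sfun \<Rightarrow> ('o, 'a, 'x, 'p, 'b, 'y) sfun \<Rightarrow> ('o \<Rightarrow> 'b) \<Rightarrow> bool" where
  "simplicial_nat_trans C D F G \<alpha> \<longleftrightarrow>
     (\<forall>X \<in> Obj C. \<alpha> X \<in> hom D (onObj F X) (onObj G X)) \<and>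
     (\<forall>X \<in> Obj C. \<forall>Y \<in> Obj C. \<forall>n. \<forall>g \<in> Simp (sMap C X Y) n.
        sComp D (onObj F X) (onObj F Y) (onObj G Y) n (arr_simplex D n (\<alpha> Y)) (onMap F X Y n g) =
        sComp D (onObj F X) (onObj G X) (onObj G Y) n (onMap G X Y n g) (arr_simplex D n (\<alpha> X)))"

text \<open>\<open>L\<close> is left adjoint to \<open>R\<close> with unit \<open>\<eta>\<close> and counit \<open>\<epsilon>\<close>.\<close>

definition simplicial_adjunction ::
  "('o, 'a, 'x, 'z) scat_scheme \<Rightarrow> ('p, 'b, 'y, 'w) scat_scheme
    \<Rightarrow> ('o, 'a, 'x, 'p, 'b, 'y) sfun \<Rightarrow> ('p, 'b, 'y, 'o, 'a, 'x) sfun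
    \<Rightarrow> ('o \<Rightarrow> 'a) \<Rightarrow> ('p \<Rightarrow> 'b) \<Rightarrow> bool" where
  "simplicial_adjunction A B L R \<eta> \<epsilon> \<longleftrightarrow>
     simplicial_functor A B L \<and> simplicial_functor B A R \<and>
     simplicial_nat_trans A A sfun_id (sfun_comp R L) \<eta> \<and>
     simplicial_nat_trans B B (sfun_comp L R) sfun_id \<epsilon> \<and>
     (\<forall>X \<in> Obj A. \<epsilon> (onObj L X) \<cdot>\<^bsub>B\<^esub> onArr L (\<eta> X) = Id B (onObj L X)) \<and>
     (\<forall>Y \<in> Obj B. onArr R (\<epsilon> Y) \<cdot>\<^bsub>A\<^esub> \<eta> (onObj R Y) = Id A (onObj R Y))"

definition quillen_adjunction ::
  "('o, 'a, 'x, 'z) smcat_scheme \<Rightarrow> ('p, 'b, 'y, 'w) smcat_scheme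
    \<Rightarrow> ('o, 'a, 'x, 'p, 'b, 'y) sfun \<Rightarrow> ('p, 'b, 'y, 'o, 'a, 'x) sfun
    \<Rightarrow> ('o \<Rightarrow> 'a) \<Rightarrow> ('p \<Rightarrow> 'b) \<Rightarrow> bool" where
  "quillen_adjunction A B L R \<eta> \<epsilon> \<longleftrightarrow>
     simplicial_adjunction A B L R \<eta> \<epsilon> \<and>
     (\<forall>i \<in> Cof A. onArr L i \<in> Cof B) \<and>
     (\<forall>i \<in> Cof A \<inter> WE A. onArr L i \<in> Cof B \<inter> WE B)"

text \<open>The adjoint of \<open>f : L X \<rightarrow> Y\<close> is \<open>R f \<circ> \<eta>\<^sub>X\<close>, that of \<open>h : X \<rightarrow> R Y\<close> is \<open>\<epsilon>\<^sub>Y \<circ> L h\<close>.\<close>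

definition adjoint_of_left ::
  "('o, 'a, 'z) cat_scheme \<Rightarrow> ('p, 'b, 'y, 'o, 'a, 'x) sfun \<Rightarrow> ('o \<Rightarrow> 'a) \<Rightarrow> 'o \<Rightarrow> 'b \<Rightarrow> 'a" where
  "adjoint_of_left A R \<eta> X f = onArr R f \<cdot>\<^bsub>A\<^esub> \<eta> X"

definition adjoint_of_right ::
  "('p, 'b, 'z) cat_scheme \<Rightarrow> ('o, 'a, 'x, 'p, 'b, 'y) sfun \<Rightarrow> ('p \<Rightarrow> 'b) \<Rightarrow> 'p \<Rightarrow> 'a \<Rightarrow> 'b" where
  "adjoint_of_right B L \<epsilon> Y h = \<epsilon> Y \<cdot>\<^bsub>B\<^esub> onArr L h"

definition quillen_equivalence ::
  "('o, 'a, 'x, 'z) smcat_scheme \<Rightarrow> ('p, 'b, 'y, 'w) smcat_scheme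
    \<Rightarrow> ('o, 'a, 'x, 'p, 'b, 'y) sfun \<Rightarrow> ('p, 'b, 'y, 'o, 'a, 'x) sfun
    \<Rightarrow> ('o \<Rightarrow> 'a) \<Rightarrow> ('p \<Rightarrow> 'b) \<Rightarrow> bool" where
  "quillen_equivalence A B L R \<eta> \<epsilon> \<longleftrightarrow>
     quillen_adjunction A B L R \<eta> \<epsilon> \<and>
     (\<forall>X Y. cofibrant A X \<and> fibrant B Y \<longrightarrow>
        (\<forall>f \<in> hom B (onObj L X) Y. f \<in> WE B \<longleftrightarrow> adjoint_of_left A R \<eta> X f \<in> WE A))"


section \<open>Left Bousfield localization at a homotopy localization functor\<close>

definition local_equivalences ::
  "('o, 'a, 'x, 'z) smcat_scheme \<Rightarrow> ('o, 'a, 'x, 'o, 'a, 'x) sfun \<Rightarrow> 'a set" where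
  "local_equivalences M F = {f \<in> Arr M. onArr F f \<in> WE M}"

text \<open>
  The cofibrations stay the same; the fibrations are then forced to be the arrows with the
  right lifting property against the cofibrations that are local equivalences.
\<close>

definition localized ::
  "('o, 'a, 'x) smcat \<Rightarrow> ('o, 'a, 'x, 'o, 'a, 'x) sfun \<Rightarrow> ('o, 'a, 'x) smcat" where
  "localized M F = M
     \<lparr>WE := local_equivalences M F,
      Fib := {p \<in> Arr M. \<forall>i \<in> Cof M \<inter> local_equivalences M F. lifts_against M i p}\<rparr>"

text \<open>
  \<open>F\<close> is a homotopy localization functor with coaugmentation \<open>j\<close> for which the left Bousfield
  localization exists, and \<open>j\<^sub>X : X \<rightarrow> F X\<close> is the fibrant replacement of \<open>X\<close> in it.
\<close>

definition homotopy_localization ::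
  "'s::infinite itself \<Rightarrow> ('o, 'a, 'x) smcat \<Rightarrow> ('o, 'a, 'x, 'o, 'a, 'x) sfun \<Rightarrow> ('o \<Rightarrow> 'a) \<Rightarrow> bool"
  where
  "homotopy_localization small M F j \<longleftrightarrow>
     simplicial_functor M M F \<and> simplicial_nat_trans M M sfun_id F j \<and>
     WE M \<subseteq> local_equivalences M F \<and>
     simplicial_model_category small (localized M F) \<and>
     (\<forall>X \<in> Obj M. j X \<in> Cof (localized M F) \<inter> WE (localized M F) \<and>
                  fibrant (localized M F) (onObj F X))"

definition local_object ::
  "('o, 'a, 'x) smcat \<Rightarrow> ('o, 'a, 'x, 'o, 'a, 'x) sfun \<Rightarrow> 'o \<Rightarrow> bool" where
  "local_object M F X \<longleftrightarrow> fibrant (localized M F) X"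

end

theory Submission
  imports Defs
begin

text \<open>
  Fibrations between local objects are fibrations of the localized structure, so \<open>R\<close> preserves
  them; since a cofibration lifting against all fibrations between fibrant objects is trivial,
  \<open>L\<close> preserves trivial cofibrations of the localized structures. For the equivalence, factor
  \<open>f : L X \<rightarrow> Y\<close>, with \<open>Y\<close> local, through the fibrant replacement of \<open>L X\<close> as \<open>g \<circ> j\<close>. As local
  equivalences between local objects are weak equivalences, \<open>f\<close> is a local equivalence iff \<open>g\<close>
  is a weak equivalence; by hypothesis on \<open>L\<close> the same holds for \<open>g\<close> composed with the map
  from \<open>L (F\<^sub>A X)\<close>, whose adjoint is a map \<open>F\<^sub>A X \<rightarrow> R Y\<close> of local objects extending the adjoint
  of \<open>f\<close>, so that the given Quillen equivalence applies.
\<close>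


section \<open>Lifting and retracts\<close>

context category
begin

lemma lifts_againstI:
  assumes "i \<in> hom C X Y" "p \<in> hom C Z W"
    and "\<And>u v. \<lbrakk>u \<in> hom C X Z; v \<in> hom C Y W; p \<cdot> u = v \<cdot> i\<rbrakk>
      \<Longrightarrow> \<exists>h \<in> hom C Y Z. h \<cdot> i = u \<and> p \<cdot> h = v"
  shows "lifts_against C i p"
  using assms unfolding lifts_against_def hom_def by simp

lemma lifts_againstE:
  assumes "lifts_against C i p" "i \<in> hom C X Y" "p \<in> hom C Z W"
    and "u \<in> hom C X Z" "v \<in> hom C Y W" "p \<cdot> u = v \<cdot> i"
  obtains h where "h \<in> hom C Y Z" "h \<cdot> i = u" "p \<cdot> h = v"
  using assms unfolding lifts_against_def hom_def by auto

lemma hom_objs: "f \<in> hom C X Y \<Longrightarrow> X \<in> Obj C" "f \<in> hom C X Y \<Longrightarrow> Y \<in> Obj C"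
  using dom_cod unfolding hom_def by auto

lemma hom_arr: "f \<in> hom C X Y \<Longrightarrow> f \<in> Arr C"
  unfolding hom_def by auto

lemma arr_hom: "f \<in> Arr C \<Longrightarrow> f \<in> hom C (Dom C f) (Cod C f)"
  unfolding hom_def by auto

lemma is_retractI:
  assumes "f \<in> hom C X Y" "g \<in> hom C Z W"
    and "i \<in> hom C X Z" "r \<in> hom C Z X" "j \<in> hom C Y W" "s \<in> hom C W Y"
    and "r \<cdot> i = Id C X" "s \<cdot> j = Id C Y" "g \<cdot> i = j \<cdot> f" "f \<cdot> r = s \<cdot> g"
  shows "is_retract C f g"
proof -
  have "f \<in> Arr C" "g \<in> Arr C" "Dom C f = X" "Cod C f = Y" "Dom C g = Z" "Cod C g = W"
    using assms(1,2) unfolding hom_def by auto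
  with assms(3-) show ?thesis unfolding is_retract_def by blast
qed

text \<open>The retract argument: a lift in the square with top \<open>Id C X\<close> and bottom
  \<open>q\<close> is a map \<open>Z\<close> to \<open>X\<close> that splits \<open>i\<close>, and
  together with identities on \<open>Y\<close> it exhibits the retract.\<close>

lemma retract_of_right_factor:
  assumes i: "i \<in> hom C X Z" and q: "q \<in> hom C Z Y" and l: "lifts_against C i (q \<cdot> i)"
  shows "is_retract C (q \<cdot> i) q"
proof -
  have f: "q \<cdot> i \<in> hom C X Y" using i q by (rule comp_hom)
  note idX = id_hom[OF hom_objs(1)[OF i]] and idY = id_hom[OF hom_objs(2)[OF q]]
  obtain h where h: "h \<in> hom C Z X" "h \<cdot> i = Id C X" "(q \<cdot> i) \<cdot> h = q"
    using lifts_againstE[OF l i f idX q] comp_id_right[OF f] by auto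
  show ?thesis
    by (rule is_retractI[OF f q i h(1) idY idY h(2)])
      (use h(3) comp_id_left[OF f] comp_id_left[OF q] comp_id_left[OF idY] in simp_all)
qed

text \<open>Dual retract argument: here the lift is a section of \<open>p\<close>, and the
  identities sit on the common domain.\<close>

lemma retract_of_left_factor:
  assumes i: "i \<in> hom C X Z" and p: "p \<in> hom C Z Y" and l: "lifts_against C (p \<cdot> i) p"
  shows "is_retract C (p \<cdot> i) i"
proof -
  have f: "p \<cdot> i \<in> hom C X Y" using i p by (rule comp_hom)
  note idX = id_hom[OF hom_objs(1)[OF i]] and idY = id_hom[OF hom_objs(2)[OF p]]
  obtain h where h: "h \<in> hom C Y Z" "h \<cdot> (p \<cdot> i) = i" "p \<cdot> h = Id C Y"
    using lifts_againstE[OF l f p i idY] comp_id_left[OF f] by auto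
  show ?thesis
    by (rule is_retractI[OF f i idX idX h(1) p _ h(3)])
      (use h(2) comp_id_right[OF f] comp_id_right[OF i] comp_id_right[OF idX] in simp_all)
qed

section \<open>Closure of lifting properties under composition and pushout\<close>

lemma lifts_against_comp_left:
  assumes i: "i \<in> hom C X Y" and k: "k \<in> hom C Y Z" and p: "p \<in> Arr C"
    and li: "lifts_against C i p" and lk: "lifts_against C k p"
  shows "lifts_against C (k \<cdot> i) p"
proof (rule lifts_againstI[OF comp_hom[OF i k] arr_hom[OF p]])
  fix u v
  assume u: "u \<in> hom C X (Dom C p)" and v: "v \<in> hom C Z (Cod C p)" and sq: "p \<cdot> u = v \<cdot> (k \<cdot> i)"
  note p' = arr_hom[OF p]
  obtain h where h: "h \<in> hom C Y (Dom C p)" "h \<cdot> i = u" "p \<cdot> h = v \<cdot> k"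
    using lifts_againstE[OF li i p' u comp_hom[OF k v]] sq comp_assoc[OF i k v] by auto
  obtain g where g: "g \<in> hom C Z (Dom C p)" "g \<cdot> k = h" "p \<cdot> g = v"
    using lifts_againstE[OF lk k p' h(1) v h(3)] by auto
  show "\<exists>h\<in>hom C Z (Dom C p). h \<cdot> (k \<cdot> i) = u \<and> p \<cdot> h = v"
    using g h comp_assoc[OF i k g(1)] by auto
qed

lemma lifts_against_comp_right:
  assumes p: "p \<in> hom C X Y" and q: "q \<in> hom C Y Z" and i: "i \<in> Arr C"
    and lp: "lifts_against C i p" and lq: "lifts_against C i q"
  shows "lifts_against C i (q \<cdot> p)"
proof (rule lifts_againstI[OF arr_hom[OF i] comp_hom[OF p q]])
  fix u v
  assume u: "u \<in> hom C (Dom C i) X" and v: "v \<in> hom C (Cod C i) Z" and sq: "(q \<cdot> p) \<cdot> u = v \<cdot> i"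
  note i' = arr_hom[OF i]
  obtain h where h: "h \<in> hom C (Cod C i) Y" "h \<cdot> i = p \<cdot> u" "q \<cdot> h = v"
    using lifts_againstE[OF lq i' q comp_hom[OF u p] v] sq comp_assoc[OF u p q] by auto
  obtain g where g: "g \<in> hom C (Cod C i) X" "g \<cdot> i = u" "p \<cdot> g = h"
    using lifts_againstE[OF lp i' p u h(1)] h(2) by auto
  show "\<exists>h\<in>hom C (Cod C i) X. h \<cdot> i = u \<and> (q \<cdot> p) \<cdot> h = v"
    using g h comp_assoc[OF g(1) p q] by auto
qed

text \<open>The elementary form keeps index categories out of all later arguments; the passage from
  \<open>is_colimit\<close> is made once, in \<open>ex_pushout\<close>.\<close>

definition is_pushout :: "'o \<Rightarrow> 'o \<Rightarrow> 'o \<Rightarrow> 'o \<Rightarrow> 'a \<Rightarrow> 'a \<Rightarrow> 'a \<Rightarrow> 'a \<Rightarrow> bool" where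
  "is_pushout X Y Z P f g a b \<longleftrightarrow> f \<in> hom C X Y \<and> g \<in> hom C X Z \<and>
     a \<in> hom C Y P \<and> b \<in> hom C Z P \<and> a \<cdot> f = b \<cdot> g \<and>
     (\<forall>W. \<forall>u \<in> hom C Y W. \<forall>v \<in> hom C Z W. u \<cdot> f = v \<cdot> g \<longrightarrow>
        (\<exists>!w. w \<in> hom C P W \<and> w \<cdot> a = u \<and> w \<cdot> b = v))"

lemma pushout_universal:
  assumes "is_pushout X Y Z P f g a b" "u \<in> hom C Y W" "v \<in> hom C Z W" "u \<cdot> f = v \<cdot> g"
  shows "\<exists>!w. w \<in> hom C P W \<and> w \<cdot> a = u \<and> w \<cdot> b = v"
  using assms unfolding is_pushout_def by blast

text \<open>Restricting a square on \<open>a\<close> along \<open>f\<close> and \<open>b\<close>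
  gives a square on \<open>g\<close>. Its lift and the top map \<open>u\<close> agree on
  \<open>X\<close>, so they glue to a map out of \<open>P\<close>.\<close>

lemma lifts_against_pushout:
  assumes po: "is_pushout X Y Z P f g a b" and p: "p \<in> Arr C" and l: "lifts_against C g p"
  shows "lifts_against C a p"
proof -
  have f: "f \<in> hom C X Y" and g: "g \<in> hom C X Z" and a: "a \<in> hom C Y P" and b: "b \<in> hom C Z P"
    and sq: "a \<cdot> f = b \<cdot> g"
    using po unfolding is_pushout_def by auto
  note p' = arr_hom[OF p]
  show ?thesis
  proof (rule lifts_againstI[OF a p'])
    fix u v
    assume u: "u \<in> hom C Y (Dom C p)" and v: "v \<in> hom C P (Cod C p)" and uv: "p \<cdot> u = v \<cdot> a"
    have "p \<cdot> (u \<cdot> f) = (v \<cdot> b) \<cdot> g"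
      using uv sq comp_assoc[OF f u p'] comp_assoc[OF f a v] comp_assoc[OF g b v] by simp
    then obtain h where h: "h \<in> hom C Z (Dom C p)" "h \<cdot> g = u \<cdot> f" "p \<cdot> h = v \<cdot> b"
      using lifts_againstE[OF l g p' comp_hom[OF f u] comp_hom[OF b v]] by auto
    obtain w where w: "w \<in> hom C P (Dom C p)" "w \<cdot> a = u" "w \<cdot> b = h"
      using pushout_universal[OF po u h(1)] h(2) by auto
    \<comment> \<open>Both sides have the same composites with \<open>a\<close> and
      \<open>b\<close>, so the uniqueness half of the universal property identifies them.\<close>
    have "p \<cdot> w = v"
    proof -
      have "(v \<cdot> a) \<cdot> f = (v \<cdot> b) \<cdot> g"
        using sq comp_assoc[OF f a v] comp_assoc[OF g b v] by simp
      note ex1 = pushout_universal[OF po comp_hom[OF a v] comp_hom[OF b v] this]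
      have "(p \<cdot> w) \<cdot> a = v \<cdot> a" "(p \<cdot> w) \<cdot> b = v \<cdot> b"
        using comp_assoc[OF a w(1) p'] comp_assoc[OF b w(1) p'] w h uv by auto
      with ex1 v comp_hom[OF w(1) p'] show ?thesis by blast
    qed
    with w show "\<exists>h\<in>hom C P (Dom C p). h \<cdot> a = u \<and> p \<cdot> h = v" by blast
  qed
qed

end

text \<open>
  The shape of a span, with objects \<open>0, 1, 2\<close>, their identities carrying the same names, and
  arrows \<open>3 : 0 \<rightarrow> 1\<close> and \<open>4 : 0 \<rightarrow> 2\<close>, transported along an injection of the natural numbers.
\<close>

definition span_shape :: "(nat \<Rightarrow> 's) \<Rightarrow> ('s, 's) cat" where
  "span_shape e = \<lparr>Obj = e ` {0, 1, 2}, Arr = e ` {0, 1, 2, 3, 4},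
     Dom = (\<lambda>x. if x = e 1 then e 1 else if x = e 2 then e 2 else e 0),
     Cod = (\<lambda>x. if x = e 0 then e 0 else if x = e 1 \<or> x = e 3 then e 1 else e 2),
     Id = id, Comp = (\<lambda>g f. if g \<in> e ` {0, 1, 2} then f else g)\<rparr>"

lemma category_span_shape: "inj e \<Longrightarrow> category (span_shape e)"
  unfolding category_def by (auto simp: span_shape_def hom_def inj_eq)

text \<open>Smallness is measured by an infinite type, which contains a copy of the natural numbers
  and hence of the span shape.\<close>

lemma (in category) ex_pushout:
  fixes small :: "'s::infinite itself"
  assumes sc: "small_cocomplete small C" and f: "f \<in> hom C X Y" and g: "g \<in> hom C X Z"
  shows "\<exists>P a b. is_pushout X Y Z P f g a b"
proof -
  obtain e :: "nat \<Rightarrow> 's" where e: "inj e"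
    using infinite_UNIV infinite_countable_subset by blast
  note inj = inj_eq[OF e]
  define Do where "Do x = (if x = e 0 then X else if x = e 1 then Y else Z)" for x
  define Da where "Da x = (if x = e 3 then f else if x = e 4 then g else Id C (Do x))" for x
  let ?J = "span_shape e"
  have ids: "Id C X \<in> hom C X X" "Id C Y \<in> hom C Y Y" "Id C Z \<in> hom C Z Z"
    using id_hom hom_objs[OF f] hom_objs[OF g] by auto
  note units = comp_id_left[OF f] comp_id_left[OF g] comp_id_right[OF f] comp_id_right[OF g]
    ids[THEN comp_id_left]
  have "is_functor ?J C Do Da"
    unfolding is_functor_def using hom_objs[OF f] hom_objs[OF g] ids f g units
    by (auto simp: span_shape_def hom_def inj Do_def Da_def)
  then obtain P \<iota> where col: "is_colimit ?J C Do Da P \<iota>"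
    using sc category_span_shape[OF e] unfolding small_cocomplete_def by blast
  \<comment> \<open>The cocone determined by \<open>u\<close> and \<open>v\<close>: its leg at the
    corner \<open>e 0\<close> is forced to be the common composite.\<close>
  define k where "k u v x = (if x = e 0 then u \<cdot> f else if x = e 1 then u else v)" for u v x
  \<comment> \<open>Identity arrows impose nothing by the unit law, so only the conditions at the
    arrows \<open>e 3\<close> and \<open>e 4\<close> remain.\<close>
  have cocone: "is_cocone ?J C Do Da W \<rho> \<longleftrightarrow> \<rho> (e 0) \<in> hom C X W \<and> \<rho> (e 1) \<in> hom C Y W \<and>
    \<rho> (e 2) \<in> hom C Z W \<and> \<rho> (e 1) \<cdot> f = \<rho> (e 0) \<and> \<rho> (e 2) \<cdot> g = \<rho> (e 0)" for W \<rho>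
    unfolding is_cocone_def
    using hom_objs comp_id_right by (auto simp: span_shape_def inj Do_def Da_def)
  define a b where "a = \<iota> (e 1)" and "b = \<iota> (e 2)"
  have \<iota>: "a \<in> hom C Y P" "b \<in> hom C Z P" "a \<cdot> f = \<iota> (e 0)" "b \<cdot> g = \<iota> (e 0)"
    using col unfolding is_colimit_def cocone a_def b_def by auto
  have uni: "\<exists>!w. w \<in> hom C P W \<and> w \<cdot> a = u \<and> w \<cdot> b = v"
    if u: "u \<in> hom C Y W" and v: "v \<in> hom C Z W" and uv: "u \<cdot> f = v \<cdot> g" for W u v
  proof -
    have "is_cocone ?J C Do Da W (k u v)"
      unfolding cocone using u v uv comp_hom[OF f u] by (auto simp: k_def inj)
    then have ex1: "\<exists>!w. w \<in> hom C P W \<and> (\<forall>j\<in>Obj ?J. w \<cdot> \<iota> j = k u v j)"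
      using col unfolding is_colimit_def by blast
    have eq: "w \<in> hom C P W \<and> (\<forall>j\<in>Obj ?J. w \<cdot> \<iota> j = k u v j) \<longleftrightarrow>
        w \<in> hom C P W \<and> w \<cdot> a = u \<and> w \<cdot> b = v" for w
      using comp_assoc[OF f \<iota>(1), of w] \<iota>(3)
      by (auto simp: span_shape_def inj k_def a_def b_def)
    show ?thesis using ex1 unfolding eq .
  qed
  have "is_pushout X Y Z P f g a b"
    unfolding is_pushout_def using f g \<iota> uni by simp
  then show ?thesis by blast
qed


section \<open>Model categories\<close>

context model_category
begin

text \<open>Lifting against the first factor of a factorization into a trivial cofibration and a
  fibration makes \<open>p\<close> a retract of the second. The three analogues below vary the
  factorization and, for cofibrations, retract to the first factor instead.\<close>

lemma mem_Fib_iff: "p \<in> Fib M \<longleftrightarrow> p \<in> Arr M \<and> (\<forall>i \<in> Cof M \<inter> WE M. lifts_against M i p)"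
proof
  assume r: "p \<in> Arr M \<and> (\<forall>i \<in> Cof M \<inter> WE M. lifts_against M i p)"
  then obtain Z i q where f: "i \<in> hom M (Dom M p) Z" "q \<in> hom M Z (Cod M p)"
      "i \<in> Cof M \<inter> WE M" "q \<in> Fib M" "p = q \<cdot> i"
    using factor_trivcof_fib[OF arr_hom] by blast
  have "is_retract M p q"
    using retract_of_right_factor[OF f(1,2)] r f(3-5) by simp
  then show "p \<in> Fib M" using retracts f(3,4) by blast
qed (use classes_arr lifting in auto)

lemma mem_trivial_Fib_iff: "p \<in> Fib M \<inter> WE M \<longleftrightarrow> p \<in> Arr M \<and> (\<forall>i \<in> Cof M. lifts_against M i p)"
proof
  assume r: "p \<in> Arr M \<and> (\<forall>i \<in> Cof M. lifts_against M i p)"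
  then obtain Z i q where f: "i \<in> hom M (Dom M p) Z" "q \<in> hom M Z (Cod M p)"
      "i \<in> Cof M" "q \<in> Fib M \<inter> WE M" "p = q \<cdot> i"
    using factor_cof_trivfib[OF arr_hom] by blast
  have "is_retract M p q"
    using retract_of_right_factor[OF f(1,2)] r f(3-5) by simp
  then show "p \<in> Fib M \<inter> WE M" using retracts f(3,4) by blast
qed (use classes_arr lifting in auto)

lemma mem_Cof_iff: "i \<in> Cof M \<longleftrightarrow> i \<in> Arr M \<and> (\<forall>p \<in> Fib M \<inter> WE M. lifts_against M i p)"
proof
  assume r: "i \<in> Arr M \<and> (\<forall>p \<in> Fib M \<inter> WE M. lifts_against M i p)"
  then obtain Z k q where f: "k \<in> hom M (Dom M i) Z" "q \<in> hom M Z (Cod M i)"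
      "k \<in> Cof M" "q \<in> Fib M \<inter> WE M" "i = q \<cdot> k"
    using factor_cof_trivfib[OF arr_hom] by blast
  have "is_retract M i k"
    using retract_of_left_factor[OF f(1,2)] r f(3-5) by simp
  then show "i \<in> Cof M" using retracts f(3,4) by blast
qed (use classes_arr lifting in auto)

lemma mem_trivial_Cof_iff: "i \<in> Cof M \<inter> WE M \<longleftrightarrow> i \<in> Arr M \<and> (\<forall>p \<in> Fib M. lifts_against M i p)"
proof
  assume r: "i \<in> Arr M \<and> (\<forall>p \<in> Fib M. lifts_against M i p)"
  then obtain Z k q where f: "k \<in> hom M (Dom M i) Z" "q \<in> hom M Z (Cod M i)"
      "k \<in> Cof M \<inter> WE M" "q \<in> Fib M" "i = q \<cdot> k"
    using factor_trivcof_fib[OF arr_hom] by blast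
  have "is_retract M i k"
    using retract_of_left_factor[OF f(1,2)] r f(3-5) by simp
  then show "i \<in> Cof M \<inter> WE M" using retracts f(3,4) by blast
qed (use classes_arr lifting in auto)

section \<open>Closure properties of cofibrations, fibrations and weak equivalences\<close>

lemma Cof_comp:
  assumes "i \<in> hom M X Y" "k \<in> hom M Y Z" "i \<in> Cof M" "k \<in> Cof M"
  shows "k \<cdot> i \<in> Cof M"
  unfolding mem_Cof_iff
proof (intro conjI ballI)
  fix p assume p: "p \<in> Fib M \<inter> WE M"
  then show "lifts_against M (k \<cdot> i) p"
    using lifts_against_comp_left[OF assms(1,2)] lifting assms(3,4) classes_arr by auto
qed (rule hom_arr[OF comp_hom[OF assms(1,2)]])

lemma Fib_comp:
  assumes "p \<in> hom M X Y" "q \<in> hom M Y Z" "p \<in> Fib M" "q \<in> Fib M"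
  shows "q \<cdot> p \<in> Fib M"
  unfolding mem_Fib_iff
proof (intro conjI ballI)
  fix i assume i: "i \<in> Cof M \<inter> WE M"
  then show "lifts_against M i (q \<cdot> p)"
    using lifts_against_comp_right[OF assms(1,2)] lifting assms(3,4) classes_arr by auto
qed (rule hom_arr[OF comp_hom[OF assms(1,2)]])

lemma trivial_Cof_pushout:
  assumes "is_pushout X Y Z P f g a b" "g \<in> Cof M \<inter> WE M"
  shows "a \<in> Cof M \<inter> WE M"
  unfolding mem_trivial_Cof_iff
proof (intro conjI ballI)
  show "a \<in> Arr M" using assms(1) hom_arr unfolding is_pushout_def by blast
  fix p assume p: "p \<in> Fib M"
  then show "lifts_against M a p"
    using lifts_against_pushout[OF assms(1)] lifting assms(2) classes_arr by auto
qed

text \<open>Identities are not weak equivalences by axiom. Factoring the identity through a trivial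
  fibration \<open>p\<close> exhibits it as a retract of \<open>p\<close>.\<close>

lemma Id_WE:
  assumes "X \<in> Obj M"
  shows "Id M X \<in> WE M"
proof -
  note id = id_hom[OF assms]
  obtain Z i p where ip: "i \<in> hom M X Z" "p \<in> hom M Z X" "p \<in> Fib M \<inter> WE M" "Id M X = p \<cdot> i"
    using factor_cof_trivfib[OF id] by blast
  have "is_retract M (Id M X) p"
    by (rule is_retractI[OF id ip(2) ip(1,2) id id])
      (use ip(4) comp_id_left[OF id] comp_id_left[OF ip(2)] in auto)
  then show ?thesis using retracts ip(3) by blast
qed

lemma WE_comp_left_iff:
  "\<lbrakk>f \<in> hom M X Y; g \<in> hom M Y Z; f \<in> WE M\<rbrakk> \<Longrightarrow> g \<cdot> f \<in> WE M \<longleftrightarrow> g \<in> WE M"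
  using two_of_three by blast

lemma WE_comp_right_iff:
  "\<lbrakk>f \<in> hom M X Y; g \<in> hom M Y Z; g \<in> WE M\<rbrakk> \<Longrightarrow> g \<cdot> f \<in> WE M \<longleftrightarrow> f \<in> WE M"
  using two_of_three by blast

lemma section_WE:
  assumes "i \<in> hom M X Y" "s \<in> hom M Y X" "s \<in> WE M" "s \<cdot> i = Id M X"
  shows "i \<in> WE M"
  using WE_comp_right_iff[OF assms(1-3)] assms(4) Id_WE[OF hom_objs(1)[OF assms(1)]] by simp

section \<open>Fibrant and cofibrant objects, extensions and homotopies\<close>

lemma fibrant_of_Fib:
  assumes p: "p \<in> hom M X Y" "p \<in> Fib M" and Y: "fibrant M Y"
  shows "fibrant M X"
proof -
  obtain T f where "is_terminal M T" "f \<in> hom M Y T" "f \<in> Fib M"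
    using Y unfolding fibrant_def by blast
  then show ?thesis
    unfolding fibrant_def using hom_objs(1)[OF p(1)] comp_hom[OF p(1)] Fib_comp[OF p(1) _ p(2)]
    by blast
qed

lemma cofibrant_of_Cof:
  assumes i: "i \<in> hom M X Y" "i \<in> Cof M" and X: "cofibrant M X"
  shows "cofibrant M Y"
proof -
  obtain I f where "is_initial M I" "f \<in> hom M I X" "f \<in> Cof M"
    using X unfolding cofibrant_def by blast
  then show ?thesis
    unfolding cofibrant_def using hom_objs(2)[OF i(1)] comp_hom[OF _ i(1)] Cof_comp[OF _ i(1) _ i(2)]
    by blast
qed

text \<open>This is lifting against the fibration from \<open>W\<close> to a terminal object, over
  which every square commutes.\<close>

lemma extend_to_fibrant:
  assumes i: "i \<in> hom M X Y" "i \<in> Cof M \<inter> WE M" and W: "fibrant M W" and u: "u \<in> hom M X W"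
  obtains h where "h \<in> hom M Y W" "h \<cdot> i = u"
proof -
  obtain T f where T: "is_terminal M T" and f: "f \<in> hom M W T" "f \<in> Fib M"
    using W unfolding fibrant_def by blast
  obtain v where v: "v \<in> hom M Y T"
    using T hom_objs(2)[OF i(1)] unfolding is_terminal_def by blast
  have "f \<cdot> u = v \<cdot> i"
    using T hom_objs(1)[OF i(1)] comp_hom[OF u f(1)] comp_hom[OF i(1) v]
    unfolding is_terminal_def by blast
  then show thesis
    using lifts_againstE[OF lifting i(1) f(1) u v] i(2) f(2) that by blast
qed

text \<open>
  The homotopy is constructed on a cylinder relative to \<open>X\<close>: the codiagonal of the pushout of
  \<open>i\<close> along itself is factored into a cofibration \<open>k\<close> and a trivial fibration \<open>s\<close>, and \<open>k\<close> is
  trivial because the coprojections are.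
\<close>

lemma relative_homotopy:
  assumes i: "i \<in> hom M X Y" "i \<in> Cof M \<inter> WE M" and W: "fibrant M W"
    and u: "u \<in> hom M Y W" and v: "v \<in> hom M Y W" and uv: "u \<cdot> i = v \<cdot> i"
  obtains Z s i\<^sub>0 i\<^sub>1 H where "s \<in> hom M Z Y" "s \<in> Fib M \<inter> WE M"
    "i\<^sub>0 \<in> hom M Y Z" "s \<cdot> i\<^sub>0 = Id M Y" "i\<^sub>1 \<in> hom M Y Z" "s \<cdot> i\<^sub>1 = Id M Y"
    "H \<in> hom M Z W" "H \<cdot> i\<^sub>0 = u" "H \<cdot> i\<^sub>1 = v"
proof -
  obtain P a b where po: "is_pushout X Y Y P i i a b"
    using ex_pushout[OF cocomplete i(1) i(1)] by blast
  have a: "a \<in> hom M Y P" and b: "b \<in> hom M Y P"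
    using po unfolding is_pushout_def by auto
  note idY = id_hom[OF hom_objs(2)[OF i(1)]]
  obtain c where c: "c \<in> hom M P Y" "c \<cdot> a = Id M Y" "c \<cdot> b = Id M Y"
    using pushout_universal[OF po idY idY] by blast
  obtain Z k s where k: "k \<in> hom M P Z" "k \<in> Cof M" and s: "s \<in> hom M Z Y" "s \<in> Fib M \<inter> WE M"
      and cks: "c = s \<cdot> k"
    using factor_cof_trivfib[OF c(1)] by blast
  have ska: "s \<cdot> (k \<cdot> a) = Id M Y" and skb: "s \<cdot> (k \<cdot> b) = Id M Y"
    using c cks comp_assoc[OF a k(1) s(1)] comp_assoc[OF b k(1) s(1)] by auto
  \<comment> \<open>A section of the trivial fibration \<open>s\<close>; since \<open>a\<close> is a
    pushout of the trivial cofibration \<open>i\<close>, two-out-of-three then applies to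
    \<open>k\<close>.\<close>
  have "k \<cdot> a \<in> WE M"
    using section_WE[OF comp_hom[OF a k(1)] s(1) _ ska] s(2) by blast
  then have "k \<in> WE M"
    using WE_comp_left_iff[OF a k(1)] trivial_Cof_pushout[OF po i(2)] by blast
  obtain w where w: "w \<in> hom M P W" "w \<cdot> a = u" "w \<cdot> b = v"
    using pushout_universal[OF po u v uv] by blast
  obtain H where H: "H \<in> hom M Z W" "H \<cdot> k = w"
    using extend_to_fibrant[OF k(1) _ W w(1)] k(2) \<open>k \<in> WE M\<close> by blast
  show thesis
    using that[OF s comp_hom[OF a k(1)] ska comp_hom[OF b k(1)] skb H(1)]
      comp_assoc[OF a k(1) H(1)] comp_assoc[OF b k(1) H(1)] w H by simp
qed

text \<open>
  With \<open>r : Y \<rightarrow> Y'\<close> a fibrant replacement, \<open>k = h \<circ> i\<close> and \<open>r = p \<circ> h\<close> are weak equivalences, an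
  instance of two-out-of-six. It follows from the axioms because the fibration \<open>p\<close> is a retract of
  a weak equivalence \<open>p \<circ> q\<close>: lifting \<open>k\<close> against \<open>q\<close> gives a section of \<open>q\<close>.
\<close>

lemma Cof_WE_of_lifts_against_fibrant:
  assumes i: "i \<in> Cof M"
    and fib: "\<And>X. X \<in> Obj M \<Longrightarrow> \<exists>Y. \<exists>r \<in> hom M X Y. r \<in> Cof M \<inter> WE M \<and> fibrant M Y"
    and lift: "\<And>p X Y. \<lbrakk>p \<in> hom M X Y; p \<in> Fib M; fibrant M X; fibrant M Y\<rbrakk> \<Longrightarrow> lifts_against M i p"
  shows "i \<in> WE M"
proof -
  define X Y where "X = Dom M i" and "Y = Cod M i"
  have ih: "i \<in> hom M X Y" using arr_hom i classes_arr unfolding X_def Y_def by blast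
  obtain Y' r where r: "r \<in> hom M Y Y'" "r \<in> Cof M \<inter> WE M" and Y': "fibrant M Y'"
    using fib[OF hom_objs(2)[OF ih]] by blast
  obtain X' k p where k: "k \<in> hom M X X'" "k \<in> Cof M \<inter> WE M" and p: "p \<in> hom M X' Y'" "p \<in> Fib M"
      and pk: "r \<cdot> i = p \<cdot> k"
    using factor_trivcof_fib[OF comp_hom[OF ih r(1)]] by blast
  \<comment> \<open>The lifting hypothesis covers \<open>p\<close> because \<open>X'\<close>, the
    source of a fibration onto the fibrant \<open>Y'\<close>, is itself fibrant.\<close>
  obtain h where h: "h \<in> hom M Y X'" "h \<cdot> i = k" "p \<cdot> h = r"
    using lifts_againstE[OF lift[OF p fibrant_of_Fib[OF p Y'] Y'] ih p(1) k(1) r(1) pk[symmetric]]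
    by blast
  obtain Z m q where m: "m \<in> hom M Y Z" "m \<in> Cof M \<inter> WE M" and q: "q \<in> hom M Z X'" "q \<in> Fib M"
      and qm: "h = q \<cdot> m"
    using factor_trivcof_fib[OF h(1)] by blast
  have pq: "p \<cdot> q \<in> WE M"
    using WE_comp_left_iff[OF m(1) comp_hom[OF q(1) p(1)]] comp_assoc[OF m(1) q(1) p(1)] qm h(3) m r
    by auto
  note idX' = id_hom[OF hom_objs(2)[OF k(1)]]
  have "q \<cdot> (m \<cdot> i) = Id M X' \<cdot> k"
    using comp_assoc[OF ih m(1) q(1)] qm h(2) comp_id_left[OF k(1)] by simp
  then obtain l where l: "l \<in> hom M X' Z" "l \<cdot> k = m \<cdot> i" "q \<cdot> l = Id M X'"
    using lifts_againstE[OF lifting k(1) q(1) comp_hom[OF ih m(1)] idX'] k(2) q(2) by blast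
  note idY' = id_hom[OF hom_objs(2)[OF p(1)]]
  have "is_retract M p (p \<cdot> q)"
    by (rule is_retractI[OF p(1) comp_hom[OF q(1) p(1)] l(1) q(1) idY' idY' l(3)])
      (use comp_assoc[OF l(1) q(1) p(1)] l(3) comp_id_left[OF p(1)] comp_id_right[OF p(1)]
        comp_id_left[OF idY'] comp_id_left[OF comp_hom[OF q(1) p(1)]] in simp_all)
  then have "p \<in> WE M" using retracts pq by blast
  then have "h \<in> WE M" using WE_comp_right_iff[OF h(1) p(1)] h(3) r by auto
  then show ?thesis using WE_comp_right_iff[OF ih h(1)] h(2) k by auto
qed

end


section \<open>Functors and adjunctions\<close>

lemma simplicial_functorD:
  assumes "simplicial_functor C D F"
  shows simplicial_functor_Obj: "X \<in> Obj C \<Longrightarrow> onObj F X \<in> Obj D"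
    and simplicial_functor_Id: "X \<in> Obj C \<Longrightarrow> onArr F (Id C X) = Id D (onObj F X)"
    and simplicial_functor_hom: "f \<in> hom C X Y \<Longrightarrow> onArr F f \<in> hom D (onObj F X) (onObj F Y)"
    and simplicial_functor_Comp: "\<lbrakk>f \<in> hom C X Y; g \<in> hom C Y Z\<rbrakk>
      \<Longrightarrow> onArr F (g \<cdot>\<^bsub>C\<^esub> f) = onArr F g \<cdot>\<^bsub>D\<^esub> onArr F f"
    and simplicial_functor_Vtx: "\<lbrakk>X \<in> Obj C; Y \<in> Obj C; f \<in> hom C X Y\<rbrakk>
      \<Longrightarrow> onMap F X Y 0 (Vtx C f) = Vtx D (onArr F f)"
  using assms unfolding simplicial_functor_def is_functor_def by blast+

text \<open>The only operator from \<open>[0]\<close> to \<open>[0]\<close> is the identity, so no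
  degeneracy is applied.\<close>

lemma (in simplicial_category) arr_simplex_0:
  assumes "f \<in> hom C X Y"
  shows "arr_simplex C 0 f = Vtx C f"
proof -
  note XY = hom_objs[OF assms]
  have "Vtx C f \<in> Simp (sMap C X Y) 0"
    using bij_betwE[OF vtx_bij[OF XY]] assms by blast
  then have "Act (sMap C X Y) 0 0 (restrict id {..0}) (Vtx C f) = Vtx C f"
    by (rule simplicial_set.act_id[OF map_sset[OF XY]])
  moreover have "(\<lambda>i\<in>{..0::nat}. 0) = restrict id {..0}" by auto
  moreover have "Dom C f = X" "Cod C f = Y" using assms unfolding hom_def by auto
  ultimately show ?thesis unfolding arr_simplex_def by (simp only:)
qed

text \<open>Degree 0 of simplicial naturality, read back on arrows by injectivity of
  \<open>Vtx\<close>. The conditions on \<open>F\<close> and \<open>G\<close> concern only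
  \<open>f\<close>, so that \<open>sfun_id\<close> and \<open>sfun_comp\<close> can be inserted
  without showing that they are simplicial functors.\<close>

lemma simplicial_nat_trans_natural:
  assumes C: "simplicial_category C" and D: "simplicial_category D"
    and \<alpha>: "simplicial_nat_trans C D F G \<alpha>" and f: "f \<in> hom C X Y"
    and Ff: "onArr F f \<in> hom D (onObj F X) (onObj F Y)" "onMap F X Y 0 (Vtx C f) = Vtx D (onArr F f)"
    and Gf: "onArr G f \<in> hom D (onObj G X) (onObj G Y)" "onMap G X Y 0 (Vtx C f) = Vtx D (onArr G f)"
  shows "\<alpha> Y \<cdot>\<^bsub>D\<^esub> onArr F f = onArr G f \<cdot>\<^bsub>D\<^esub> \<alpha> X"
proof -
  interpret C: simplicial_category C by fact
  interpret D: simplicial_category D by fact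
  note XY = C.hom_objs[OF f]
  have \<alpha>X: "\<alpha> X \<in> hom D (onObj F X) (onObj G X)" and \<alpha>Y: "\<alpha> Y \<in> hom D (onObj F Y) (onObj G Y)"
    using \<alpha> XY unfolding simplicial_nat_trans_def by auto
  have "Vtx C f \<in> Simp (sMap C X Y) 0"
    using bij_betwE[OF C.vtx_bij[OF XY]] f by blast
  then have "sComp D (onObj F X) (onObj F Y) (onObj G Y) 0 (arr_simplex D 0 (\<alpha> Y)) (onMap F X Y 0 (Vtx C f))
      = sComp D (onObj F X) (onObj G X) (onObj G Y) 0 (onMap G X Y 0 (Vtx C f)) (arr_simplex D 0 (\<alpha> X))"
    using \<alpha> XY unfolding simplicial_nat_trans_def by blast
  then have "Vtx D (\<alpha> Y \<cdot>\<^bsub>D\<^esub> onArr F f) = Vtx D (onArr G f \<cdot>\<^bsub>D\<^esub> \<alpha> X)"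
    unfolding D.vtx_comp[OF Ff(1) \<alpha>Y] D.vtx_comp[OF \<alpha>X Gf(1)] Ff(2) Gf(2)
      D.arr_simplex_0[OF \<alpha>X] D.arr_simplex_0[OF \<alpha>Y] .
  then show ?thesis
    using bij_betw_imp_inj_on[OF D.vtx_bij[OF D.hom_objs(1)[OF Ff(1)] D.hom_objs(2)[OF \<alpha>Y]]]
      D.comp_hom[OF Ff(1) \<alpha>Y] D.comp_hom[OF \<alpha>X Gf(1)] by (blast dest: inj_onD)
qed

section \<open>Transposition of arrows and lifting problems along an adjunction\<close>

locale simplicial_adjoint_pair = A: simplicial_category A + B: simplicial_category B
  for A :: "('o, 'a, 'x, 'z) scat_scheme" and B :: "('p, 'b, 'y, 'w) scat_scheme" +
  fixes L :: "('o, 'a, 'x, 'p, 'b, 'y) sfun" and R :: "('p, 'b, 'y, 'o, 'a, 'x) sfun"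
    and \<eta> :: "'o \<Rightarrow> 'a" and \<epsilon> :: "'p \<Rightarrow> 'b"
  assumes adjunction: "simplicial_adjunction A B L R \<eta> \<epsilon>"
begin

abbreviation "sharp \<equiv> adjoint_of_left A R \<eta>"
abbreviation "flat \<equiv> adjoint_of_right B L \<epsilon>"

lemma L: "simplicial_functor A B L" and R: "simplicial_functor B A R"
  using adjunction unfolding simplicial_adjunction_def by auto

lemma unit_hom: "X \<in> Obj A \<Longrightarrow> \<eta> X \<in> hom A X (onObj R (onObj L X))"
  and counit_hom: "Y \<in> Obj B \<Longrightarrow> \<epsilon> Y \<in> hom B (onObj L (onObj R Y)) Y"
  using adjunction
  unfolding simplicial_adjunction_def simplicial_nat_trans_def sfun_id_def sfun_comp_def by auto

lemma unit_natural:
  assumes "f \<in> hom A X Y"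
  shows "\<eta> Y \<cdot>\<^bsub>A\<^esub> f = onArr R (onArr L f) \<cdot>\<^bsub>A\<^esub> \<eta> X"
proof -
  have "simplicial_nat_trans A A sfun_id (sfun_comp R L) \<eta>"
    using adjunction unfolding simplicial_adjunction_def by blast
  note nat = simplicial_nat_trans_natural[OF A.simplicial_category_axioms A.simplicial_category_axioms
      this assms, unfolded sfun_id_def sfun_comp_def, simplified]
  note XY = A.hom_objs[OF assms] and Lf = simplicial_functor_hom[OF L assms]
  show ?thesis
    using nat[OF assms simplicial_functor_hom[OF R Lf]] simplicial_functor_Vtx[OF L XY assms]
      simplicial_functor_Vtx[OF R B.hom_objs[OF Lf] Lf] by simp
qed

lemma counit_natural:
  assumes "f \<in> hom B X Y"
  shows "\<epsilon> Y \<cdot>\<^bsub>B\<^esub> onArr L (onArr R f) = f \<cdot>\<^bsub>B\<^esub> \<epsilon> X"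
proof -
  have "simplicial_nat_trans B B (sfun_comp L R) sfun_id \<epsilon>"
    using adjunction unfolding simplicial_adjunction_def by blast
  note nat = simplicial_nat_trans_natural[OF B.simplicial_category_axioms B.simplicial_category_axioms
      this assms, unfolded sfun_id_def sfun_comp_def, simplified]
  note XY = B.hom_objs[OF assms] and Rf = simplicial_functor_hom[OF R assms]
  show ?thesis
    using nat[OF simplicial_functor_hom[OF L Rf] _ assms] simplicial_functor_Vtx[OF R XY assms]
      simplicial_functor_Vtx[OF L A.hom_objs[OF Rf] Rf] by simp
qed

lemma sharp_hom:
  assumes "X \<in> Obj A" "f \<in> hom B (onObj L X) Y"
  shows "sharp X f \<in> hom A X (onObj R Y)"
  unfolding adjoint_of_left_def
  using A.comp_hom[OF unit_hom[OF assms(1)] simplicial_functor_hom[OF R assms(2)]] .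

lemma flat_hom:
  assumes "Y \<in> Obj B" "h \<in> hom A X (onObj R Y)"
  shows "flat Y h \<in> hom B (onObj L X) Y"
  unfolding adjoint_of_right_def
  using B.comp_hom[OF simplicial_functor_hom[OF L assms(2)] counit_hom[OF assms(1)]] .

text \<open>Naturality of the unit moves \<open>h\<close> past \<eta>, and the triangle identity at
  \<open>R Y\<close> cancels what remains. The converse \<open>flat_sharp\<close> is dual.\<close>

lemma sharp_flat:
  assumes Y: "Y \<in> Obj B" and h: "h \<in> hom A X (onObj R Y)"
  shows "sharp X (flat Y h) = h"
proof -
  note X = A.hom_objs(1)[OF h]
  note Lh = simplicial_functor_hom[OF L h]
  note R\<epsilon> = simplicial_functor_hom[OF R counit_hom[OF Y]]
  have "sharp X (flat Y h) = (onArr R (\<epsilon> Y) \<cdot>\<^bsub>A\<^esub> onArr R (onArr L h)) \<cdot>\<^bsub>A\<^esub> \<eta> X"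
    unfolding adjoint_of_left_def adjoint_of_right_def
    using simplicial_functor_Comp[OF R Lh counit_hom[OF Y]] by simp
  also have "\<dots> = onArr R (\<epsilon> Y) \<cdot>\<^bsub>A\<^esub> (\<eta> (onObj R Y) \<cdot>\<^bsub>A\<^esub> h)"
    using A.comp_assoc[OF unit_hom[OF X] simplicial_functor_hom[OF R Lh] R\<epsilon>] unit_natural[OF h] by simp
  also have "\<dots> = Id A (onObj R Y) \<cdot>\<^bsub>A\<^esub> h"
    using A.comp_assoc[OF h unit_hom[OF A.hom_objs(2)[OF h]] R\<epsilon>] adjunction Y
    unfolding simplicial_adjunction_def by simp
  finally show ?thesis using A.comp_id_left[OF h] by simp
qed

lemma flat_sharp:
  assumes X: "X \<in> Obj A" and f: "f \<in> hom B (onObj L X) Y"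
  shows "flat Y (sharp X f) = f"
proof -
  note Y = B.hom_objs(2)[OF f]
  note Rf = simplicial_functor_hom[OF R f]
  note L\<eta> = simplicial_functor_hom[OF L unit_hom[OF X]]
  have "flat Y (sharp X f) = \<epsilon> Y \<cdot>\<^bsub>B\<^esub> (onArr L (onArr R f) \<cdot>\<^bsub>B\<^esub> onArr L (\<eta> X))"
    unfolding adjoint_of_left_def adjoint_of_right_def
    using simplicial_functor_Comp[OF L unit_hom[OF X] Rf] by simp
  also have "\<dots> = (f \<cdot>\<^bsub>B\<^esub> \<epsilon> (onObj L X)) \<cdot>\<^bsub>B\<^esub> onArr L (\<eta> X)"
    using B.comp_assoc[OF L\<eta> simplicial_functor_hom[OF L Rf] counit_hom[OF Y]] counit_natural[OF f] by simp
  also have "\<dots> = f \<cdot>\<^bsub>B\<^esub> Id B (onObj L X)"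
    using B.comp_assoc[OF L\<eta> counit_hom[OF B.hom_objs(1)[OF f]] f] adjunction X
    unfolding simplicial_adjunction_def by simp
  finally show ?thesis using B.comp_id_right[OF f] by simp
qed

lemma sharp_comp_left:
  assumes X: "X \<in> Obj A" and f: "f \<in> hom B (onObj L X) Y" and p: "p \<in> hom B Y Z"
  shows "sharp X (p \<cdot>\<^bsub>B\<^esub> f) = onArr R p \<cdot>\<^bsub>A\<^esub> sharp X f"
  unfolding adjoint_of_left_def simplicial_functor_Comp[OF R f p]
  using A.comp_assoc[OF unit_hom[OF X] simplicial_functor_hom[OF R f] simplicial_functor_hom[OF R p]]
  by simp

lemma sharp_comp_right:
  assumes i: "i \<in> hom A X X'" and f: "f \<in> hom B (onObj L X') Y"
  shows "sharp X (f \<cdot>\<^bsub>B\<^esub> onArr L i) = sharp X' f \<cdot>\<^bsub>A\<^esub> i"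
proof -
  note X = A.hom_objs[OF i] and Li = simplicial_functor_hom[OF L i]
  note Rf = simplicial_functor_hom[OF R f]
  have "sharp X (f \<cdot>\<^bsub>B\<^esub> onArr L i) = onArr R f \<cdot>\<^bsub>A\<^esub> (\<eta> X' \<cdot>\<^bsub>A\<^esub> i)"
    unfolding adjoint_of_left_def simplicial_functor_Comp[OF R Li f] unit_natural[OF i]
    using A.comp_assoc[OF unit_hom[OF X(1)] simplicial_functor_hom[OF R Li] Rf] by simp
  then show ?thesis
    unfolding adjoint_of_left_def using A.comp_assoc[OF i unit_hom[OF X(2)] Rf] by simp
qed

text \<open>The square is transposed by \<open>flat\<close>, solved in \<open>B\<close>, and the
  lift is transposed back by \<open>sharp\<close>.\<close>

lemma lifts_against_right_adjoint:
  assumes i: "i \<in> hom A X Y" and p: "p \<in> hom B Z W" and l: "lifts_against B (onArr L i) p"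
  shows "lifts_against A i (onArr R p)"
proof (rule A.lifts_againstI[OF i simplicial_functor_hom[OF R p]])
  note X = A.hom_objs[OF i] and Z = B.hom_objs[OF p]
  fix u v
  assume u: "u \<in> hom A X (onObj R Z)" and v: "v \<in> hom A Y (onObj R W)"
    and sq: "onArr R p \<cdot>\<^bsub>A\<^esub> u = v \<cdot>\<^bsub>A\<^esub> i"
  note u' = flat_hom[OF Z(1) u] and v' = flat_hom[OF Z(2) v] and Li = simplicial_functor_hom[OF L i]
  \<comment> \<open>Commutativity of the transposed square is checked after applying
    \<open>sharp\<close>, which is injective by \<open>flat_sharp\<close>.\<close>
  have "sharp X (p \<cdot>\<^bsub>B\<^esub> flat Z u) = sharp X (flat W v \<cdot>\<^bsub>B\<^esub> onArr L i)"
    using sharp_comp_left[OF X(1) u' p] sharp_comp_right[OF i v'] sharp_flat[OF Z(1) u]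
      sharp_flat[OF Z(2) v] sq by simp
  then have "p \<cdot>\<^bsub>B\<^esub> flat Z u = flat W v \<cdot>\<^bsub>B\<^esub> onArr L i"
    using flat_sharp[OF X(1) B.comp_hom[OF u' p]] flat_sharp[OF X(1) B.comp_hom[OF Li v']] by metis
  then obtain h where h: "h \<in> hom B (onObj L Y) Z" "h \<cdot>\<^bsub>B\<^esub> onArr L i = flat Z u"
      "p \<cdot>\<^bsub>B\<^esub> h = flat W v"
    using B.lifts_againstE[OF l Li p u' v'] by blast
  show "\<exists>h\<in>hom A Y (onObj R Z). h \<cdot>\<^bsub>A\<^esub> i = u \<and> onArr R p \<cdot>\<^bsub>A\<^esub> h = v"
    using sharp_hom[OF X(2) h(1)] sharp_comp_right[OF i h(1)] sharp_comp_left[OF X(2) h(1) p]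
      h(2,3) sharp_flat[OF Z(1) u] sharp_flat[OF Z(2) v] by auto
qed

lemma lifts_against_left_adjoint:
  assumes i: "i \<in> hom A X Y" and p: "p \<in> hom B Z W" and l: "lifts_against A i (onArr R p)"
  shows "lifts_against B (onArr L i) p"
proof (rule B.lifts_againstI[OF simplicial_functor_hom[OF L i] p])
  note X = A.hom_objs[OF i] and Z = B.hom_objs[OF p]
  fix u v
  assume u: "u \<in> hom B (onObj L X) Z" and v: "v \<in> hom B (onObj L Y) W"
    and sq: "p \<cdot>\<^bsub>B\<^esub> u = v \<cdot>\<^bsub>B\<^esub> onArr L i"
  note u' = sharp_hom[OF X(1) u] and v' = sharp_hom[OF X(2) v] and Li = simplicial_functor_hom[OF L i]
  have "onArr R p \<cdot>\<^bsub>A\<^esub> sharp X u = sharp Y v \<cdot>\<^bsub>A\<^esub> i"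
    using sharp_comp_left[OF X(1) u p] sharp_comp_right[OF i v] sq by simp
  then obtain h where h: "h \<in> hom A Y (onObj R Z)" "h \<cdot>\<^bsub>A\<^esub> i = sharp X u"
      "onArr R p \<cdot>\<^bsub>A\<^esub> h = sharp Y v"
    using A.lifts_againstE[OF l i simplicial_functor_hom[OF R p] u' v'] by blast
  note h' = flat_hom[OF Z(1) h(1)]
  have "flat Z h \<cdot>\<^bsub>B\<^esub> onArr L i = u"
    using sharp_comp_right[OF i h'] sharp_flat[OF Z(1) h(1)] h(2)
      flat_sharp[OF X(1) u] flat_sharp[OF X(1) B.comp_hom[OF Li h']] by metis
  moreover have "p \<cdot>\<^bsub>B\<^esub> flat Z h = v"
    using sharp_comp_left[OF X(2) h' p] sharp_flat[OF Z(1) h(1)] h(3)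
      flat_sharp[OF X(2) v] flat_sharp[OF X(2) B.comp_hom[OF h' p]] by metis
  ultimately show "\<exists>h\<in>hom B (onObj L Y) Z. h \<cdot>\<^bsub>B\<^esub> onArr L i = u \<and> p \<cdot>\<^bsub>B\<^esub> h = v"
    using h' by blast
qed

end


section \<open>Left Bousfield localizations\<close>

lemma localized_simps [simp]:
  "Obj (localized M F) = Obj M" "Arr (localized M F) = Arr M" "Id (localized M F) = Id M"
  "Comp (localized M F) = Comp M" "Cof (localized M F) = Cof M"
  "WE (localized M F) = local_equivalences M F"
  "hom (localized M F) X Y = hom M X Y"
  by (simp_all add: localized_def hom_def)

lemma lifts_against_localized [simp]: "lifts_against (localized M F) i p = lifts_against M i p"
  by (simp add: localized_def lifts_against_def hom_def)

lemma is_retract_localized [simp]: "is_retract (localized M F) f g = is_retract M f g"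
  by (simp add: localized_def is_retract_def hom_def)

lemma cofibrant_localized [simp]: "cofibrant (localized M F) X = cofibrant M X"
  by (simp add: cofibrant_def is_initial_def)

lemma simplicial_adjunction_localized [simp]:
  "simplicial_adjunction (localized A F) (localized B G) L R \<eta> \<epsilon>
    = simplicial_adjunction A B L R \<eta> \<epsilon>"
  by (simp add: localized_def simplicial_adjunction_def simplicial_functor_def is_functor_def
      simplicial_nat_trans_def arr_simplex_def hom_def)

locale bousfield_localization =
  fixes small :: "'s::infinite itself" and M :: "('o, 'a, 'x) smcat"
    and F :: "('o, 'a, 'x, 'o, 'a, 'x) sfun" and j :: "'o \<Rightarrow> 'a"
  assumes simplicial_model: "simplicial_model_category small M"
    and localization: "homotopy_localization small M F j"

sublocale bousfield_localization \<subseteq> M: simplicial_model_category small M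
  by (rule simplicial_model)

text \<open>The rewrites phrase the facts of \<open>N\<close> in the category underlying
  \<open>M\<close>, so that facts about both structures combine on the same arrows; only the
  fibrations and fibrant objects still mention \<open>localized\<close>.\<close>

sublocale bousfield_localization \<subseteq> N: model_category small "localized M F"
  rewrites "Obj (localized M F) = Obj M" and "Arr (localized M F) = Arr M"
    and "Id (localized M F) = Id M" and "Comp (localized M F) = Comp M"
    and "Cof (localized M F) = Cof M" and "WE (localized M F) = local_equivalences M F"
    and "hom (localized M F) = hom M" and "lifts_against (localized M F) = lifts_against M"
    and "is_retract (localized M F) = is_retract M"
  using localization unfolding homotopy_localization_def simplicial_model_category_def
  by (auto simp: fun_eq_iff)

context bousfield_localization
begin

lemma F: "simplicial_functor M M F"
  and WE_local_equivalence: "WE M \<subseteq> local_equivalences M F"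
  and j_nat: "simplicial_nat_trans M M sfun_id F j"
  and j_trivial_Cof: "X \<in> Obj M \<Longrightarrow> j X \<in> Cof M \<inter> local_equivalences M F"
  and fibrant_F: "X \<in> Obj M \<Longrightarrow> fibrant (localized M F) (onObj F X)"
  using localization unfolding homotopy_localization_def by auto

lemma j_hom: "X \<in> Obj M \<Longrightarrow> j X \<in> hom M X (onObj F X)"
  using j_nat unfolding simplicial_nat_trans_def sfun_id_def by auto

lemma j_natural:
  assumes "f \<in> hom M X Y"
  shows "j Y \<cdot>\<^bsub>M\<^esub> f = onArr F f \<cdot>\<^bsub>M\<^esub> j X"
  using simplicial_nat_trans_natural[OF M.simplicial_category_axioms M.simplicial_category_axioms
      j_nat assms] simplicial_functor_hom[OF F assms] simplicial_functor_Vtx[OF F M.hom_objs[OF assms] assms]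
    assms
  by (simp add: sfun_id_def)

lemma local_equivalence_iff: "f \<in> hom M X Y \<Longrightarrow> f \<in> local_equivalences M F \<longleftrightarrow> onArr F f \<in> WE M"
  unfolding local_equivalences_def hom_def by auto

text \<open>Trivial fibrations are determined by lifting against the cofibrations, which the two
  structures share.\<close>

lemma trivial_Fib_localized: "Fib (localized M F) \<inter> local_equivalences M F = Fib M \<inter> WE M"
  unfolding set_eq_iff M.mem_trivial_Fib_iff N.mem_trivial_Fib_iff by simp

text \<open>Localizing enlarges the class of trivial cofibrations, so fewer maps lift against all of
  them.\<close>

lemma Fib_localized_subset: "Fib (localized M F) \<subseteq> Fib M"
proof
  fix p assume "p \<in> Fib (localized M F)"
  then show "p \<in> Fib M"
    unfolding M.mem_Fib_iff N.mem_Fib_iff using WE_local_equivalence by auto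
qed

lemma fibrant_localized:
  assumes "fibrant (localized M F) X"
  shows "fibrant M X"
  using assms Fib_localized_subset unfolding fibrant_def is_terminal_def by auto

text \<open>
  The maps \<open>j\<^bsub>FY\<^esub>\<close> and \<open>F j\<^sub>Y\<close> agree after composition with \<open>j\<^sub>Y\<close>, so they are homotopic, and the
  second is a weak equivalence. The homotopy lives on a cylinder whose projection is a trivial
  fibration of the localized structure, hence of the original one.
\<close>

lemma j_F_WE:
  assumes Y: "Y \<in> Obj M"
  shows "j (onObj F Y) \<in> WE M"
proof -
  note jY = j_hom[OF Y]
  note FY = M.hom_objs(2)[OF jY]
  note FjY = simplicial_functor_hom[OF F jY]
  obtain Z s i\<^sub>0 i\<^sub>1 H where s: "s \<in> hom M Z (onObj F Y)" "s \<in> Fib (localized M F) \<inter> local_equivalences M F"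
    and i: "i\<^sub>0 \<in> hom M (onObj F Y) Z" "s \<cdot>\<^bsub>M\<^esub> i\<^sub>0 = Id M (onObj F Y)"
      "i\<^sub>1 \<in> hom M (onObj F Y) Z" "s \<cdot>\<^bsub>M\<^esub> i\<^sub>1 = Id M (onObj F Y)"
    and H: "H \<in> hom M Z (onObj F (onObj F Y))" "H \<cdot>\<^bsub>M\<^esub> i\<^sub>0 = j (onObj F Y)"
      "H \<cdot>\<^bsub>M\<^esub> i\<^sub>1 = onArr F (j Y)"
    by (rule N.relative_homotopy[OF jY j_trivial_Cof[OF Y] fibrant_F[OF FY] j_hom[OF FY] FjY
          j_natural[OF jY]]) (rule that; assumption)
  have sW: "s \<in> WE M" using s(2) trivial_Fib_localized by blast
  have "onArr F (j Y) \<in> WE M"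
    using j_trivial_Cof[OF Y] local_equivalence_iff[OF jY] by blast
  then have "H \<in> WE M"
    using M.WE_comp_left_iff[OF i(3) H(1) M.section_WE[OF i(3) s(1) sW i(4)]] H(3) by simp
  then show ?thesis
    using M.WE_comp_left_iff[OF i(1) H(1) M.section_WE[OF i(1) s(1) sW i(2)]] H(2) by simp
qed

text \<open>Since \<open>X\<close> is local, its identity extends along \<open>j X\<close> to a
  retraction \<open>r\<close>. By naturality of \<open>j\<close>, the maps \<open>r\<close> and
  \<open>F r\<close> make \<open>j X\<close> a retract of \<open>j (F X)\<close>, a weak equivalence
  by \<open>j_F_WE\<close>.\<close>

lemma j_WE_of_fibrant:
  assumes X: "fibrant (localized M F) X"
  shows "j X \<in> WE M"
proof -
  have X': "X \<in> Obj M" using X unfolding fibrant_def by simp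
  note jX = j_hom[OF X'] and idX = M.id_hom[OF X']
  note FX = M.hom_objs(2)[OF jX]
  obtain r where r: "r \<in> hom M (onObj F X) X" "r \<cdot>\<^bsub>M\<^esub> j X = Id M X"
    using N.extend_to_fibrant[OF jX j_trivial_Cof[OF X'] X idX] by blast
  have "onArr F r \<cdot>\<^bsub>M\<^esub> onArr F (j X) = Id M (onObj F X)"
    using simplicial_functor_Comp[OF F jX r(1)] r(2) simplicial_functor_Id[OF F X'] by simp
  then have "is_retract M (j X) (j (onObj F X))"
    using M.is_retractI[OF jX j_hom[OF FX] jX r(1) simplicial_functor_hom[OF F jX]
        simplicial_functor_hom[OF F r(1)] r(2)] j_natural[OF jX] j_natural[OF r(1)] by simp
  then show ?thesis using M.retracts j_F_WE[OF X'] by blast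
qed

text \<open>In the naturality square of \<open>j\<close> at \<open>f\<close> both components of
  \<open>j\<close> are weak equivalences, so two-out-of-three compares \<open>f\<close> with
  \<open>F f\<close>.\<close>

lemma local_equivalence_iff_WE:
  assumes f: "f \<in> hom M X Y" and X: "fibrant (localized M F) X" and Y: "fibrant (localized M F) Y"
  shows "f \<in> local_equivalences M F \<longleftrightarrow> f \<in> WE M"
proof -
  note XY = M.hom_objs[OF f]
  have "f \<in> WE M \<longleftrightarrow> j Y \<cdot>\<^bsub>M\<^esub> f \<in> WE M"
    using M.WE_comp_right_iff[OF f j_hom[OF XY(2)] j_WE_of_fibrant[OF Y]] by simp
  also have "\<dots> \<longleftrightarrow> onArr F f \<in> WE M"
    using M.WE_comp_left_iff[OF j_hom[OF XY(1)] simplicial_functor_hom[OF F f] j_WE_of_fibrant[OF X]]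
      j_natural[OF f] by simp
  finally show ?thesis using local_equivalence_iff[OF f] by simp
qed

text \<open>When \<open>p\<close> is factored in the localized structure, the middle object is again
  local. The first factor is then a trivial cofibration of \<open>M\<close> itself, and the retract
  argument applies.\<close>

lemma Fib_localized_of_fibrant:
  assumes p: "p \<in> hom M X Y" "p \<in> Fib M"
    and X: "fibrant (localized M F) X" and Y: "fibrant (localized M F) Y"
  shows "p \<in> Fib (localized M F)"
proof -
  obtain Z i q where i: "i \<in> hom M X Z" "i \<in> Cof M \<inter> local_equivalences M F"
    and q: "q \<in> hom M Z Y" "q \<in> Fib (localized M F)" and piq: "p = q \<cdot>\<^bsub>M\<^esub> i"
    using N.factor_trivcof_fib[OF p(1)] by blast
  have "i \<in> WE M"
    using local_equivalence_iff_WE[OF i(1) X N.fibrant_of_Fib[OF q Y]] i(2) by blast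
  then have "lifts_against M i p" using M.lifting i(2) p(2) by blast
  then have "is_retract M p q" using M.retract_of_right_factor[OF i(1) q(1)] piq by simp
  then show ?thesis using N.retracts q(2) by blast
qed

end


section \<open>The localized adjunction\<close>

theorem theoremA1:
  fixes small :: "'s::infinite itself"
    and A :: "('o, 'a, 'x) smcat" and B :: "('p, 'b, 'y) smcat"
    and L :: "('o, 'a, 'x, 'p, 'b, 'y) sfun" and R :: "('p, 'b, 'y, 'o, 'a, 'x) sfun"
    and \<eta> :: "'o \<Rightarrow> 'a" and \<epsilon> :: "'p \<Rightarrow> 'b"
    and FA :: "('o, 'a, 'x, 'o, 'a, 'x) sfun" and jA :: "'o \<Rightarrow> 'a"
    and FB :: "('p, 'b, 'y, 'p, 'b, 'y) sfun" and jB :: "'p \<Rightarrow> 'b"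
  assumes "simplicial_model_category small A" and "simplicial_model_category small B"
    and "quillen_equivalence A B L R \<eta> \<epsilon>"
    and "homotopy_localization small A FA jA" and "homotopy_localization small B FB jB"
    and local_objects: "\<And>Y. local_object B FB Y \<Longrightarrow> local_object A FA (onObj R Y)"
    and commutes: "\<And>X. cofibrant A X \<Longrightarrow>
      \<exists>h \<in> hom A (onObj FA X) (onObj R (onObj FB (onObj L X))).
        h \<cdot>\<^bsub>A\<^esub> jA X = onArr R (jB (onObj L X)) \<cdot>\<^bsub>A\<^esub> \<eta> X \<and>
        adjoint_of_right B L \<epsilon> (onObj FB (onObj L X)) h \<in> WE B"
  shows "quillen_equivalence (localized A FA) (localized B FB) L R \<eta> \<epsilon>"
proof -
  interpret A: bousfield_localization small A FA jA
    by (intro bousfield_localization.intro assms)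
  interpret B: bousfield_localization small B FB jB
    by (intro bousfield_localization.intro assms)
  interpret simplicial_adjoint_pair A B L R \<eta> \<epsilon>
    using assms(3) A.M.simplicial_category_axioms B.M.simplicial_category_axioms
    unfolding quillen_equivalence_def quillen_adjunction_def
    by (simp add: simplicial_adjoint_pair_def simplicial_adjoint_pair_axioms_def)
  have L_Cof: "\<And>i. i \<in> Cof A \<Longrightarrow> onArr L i \<in> Cof B"
    and L_trivial_Cof: "\<And>i. i \<in> Cof A \<inter> WE A \<Longrightarrow> onArr L i \<in> Cof B \<inter> WE B"
    and WE_iff: "\<And>X Y f. \<lbrakk>cofibrant A X; fibrant B Y; f \<in> hom B (onObj L X) Y\<rbrakk>
      \<Longrightarrow> f \<in> WE B \<longleftrightarrow> sharp X f \<in> WE A"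
    using assms(3) unfolding quillen_equivalence_def quillen_adjunction_def by auto
  have R_local: "fibrant (localized A FA) (onObj R Y)" if "fibrant (localized B FB) Y" for Y
    using local_objects that unfolding local_object_def .
  \<comment> \<open>By transposition, since \<open>L\<close> preserves trivial cofibrations.\<close>
  have R_Fib: "onArr R p \<in> Fib A" if p: "p \<in> hom B Z W" "p \<in> Fib B" for p Z W
    unfolding A.M.mem_Fib_iff
  proof (intro conjI ballI)
    show "onArr R p \<in> Arr A" using A.M.hom_arr[OF simplicial_functor_hom[OF R p(1)]] .
    fix i assume i: "i \<in> Cof A \<inter> WE A"
    then have "i \<in> hom A (Dom A i) (Cod A i)" using A.M.arr_hom A.M.classes_arr by blast
    then show "lifts_against A i (onArr R p)"
      using lifts_against_right_adjoint[OF _ p(1)] B.M.lifting[OF _ p(2)] L_trivial_Cof[OF i] by blast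
  qed
  have L_local: "onArr L i \<in> local_equivalences B FB" if i: "i \<in> Cof A \<inter> local_equivalences A FA" for i
  proof (rule B.N.Cof_WE_of_lifts_against_fibrant)
    show "onArr L i \<in> Cof B" using L_Cof i by blast
    show "\<exists>Y. \<exists>r\<in>hom B X Y. r \<in> Cof B \<inter> local_equivalences B FB \<and> fibrant (localized B FB) Y"
      if "X \<in> Obj B" for X
      using B.j_hom[OF that] B.j_trivial_Cof[OF that] B.fibrant_F[OF that] by blast
    fix p Z W
    assume p: "p \<in> hom B Z W" "p \<in> Fib (localized B FB)"
      and Z: "fibrant (localized B FB) Z" and W: "fibrant (localized B FB) W"
    have "p \<in> Fib B" using p(2) B.Fib_localized_subset by blast
    then have "onArr R p \<in> Fib (localized A FA)"
      using A.Fib_localized_of_fibrant[OF simplicial_functor_hom[OF R p(1)] R_Fib[OF p(1)]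
          R_local[OF Z] R_local[OF W]] by blast
    then have "lifts_against A i (onArr R p)" using A.N.lifting i by blast
    moreover have "i \<in> hom A (Dom A i) (Cod A i)" using i A.M.arr_hom A.M.classes_arr by blast
    ultimately show "lifts_against B (onArr L i) p"
      using lifts_against_left_adjoint[OF _ p(1)] by blast
  qed
  have main: "f \<in> local_equivalences B FB \<longleftrightarrow> sharp X f \<in> local_equivalences A FA"
    if X: "cofibrant A X" and Y: "fibrant (localized B FB) Y" and f: "f \<in> hom B (onObj L X) Y" for X Y f
  proof -
    have X': "X \<in> Obj A" using X unfolding cofibrant_def by blast
    define W where "W = onObj FB (onObj L X)"
    have LX: "onObj L X \<in> Obj B" using simplicial_functor_Obj[OF L X'] .
    have jB: "jB (onObj L X) \<in> hom B (onObj L X) W" unfolding W_def using B.j_hom[OF LX] .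
    have W: "fibrant (localized B FB) W" unfolding W_def using B.fibrant_F[OF LX] .
    \<comment> \<open>The arrow \<open>flat W h\<close> is the comparison map from
      \<open>L (FA X)\<close> to the fibrant replacement \<open>W\<close> of
      \<open>L X\<close>.\<close>
    obtain h where h: "h \<in> hom A (onObj FA X) (onObj R W)"
      and hj: "h \<cdot>\<^bsub>A\<^esub> jA X = onArr R (jB (onObj L X)) \<cdot>\<^bsub>A\<^esub> \<eta> X" and hW: "flat W h \<in> WE B"
      using commutes[OF X] unfolding W_def by blast
    obtain g where g: "g \<in> hom B W Y" and gj: "g \<cdot>\<^bsub>B\<^esub> jB (onObj L X) = f"
      using B.N.extend_to_fibrant[OF jB B.j_trivial_Cof[OF LX] Y f] by blast
    note jA = A.j_hom[OF X']
    note FAX = A.M.hom_objs(2)[OF jA]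
    note Rg = simplicial_functor_hom[OF R g]
    note Rgh = A.M.comp_hom[OF h Rg]
    note h' = flat_hom[OF B.M.hom_objs(2)[OF jB] h]
    have gh: "sharp (onObj FA X) (g \<cdot>\<^bsub>B\<^esub> flat W h) = onArr R g \<cdot>\<^bsub>A\<^esub> h"
      using sharp_comp_left[OF FAX h' g] sharp_flat[OF B.M.hom_objs(2)[OF jB] h] by simp
    \<comment> \<open>The given Quillen equivalence is used at \<open>FA X\<close> rather than
      \<open>X\<close>: this object is cofibrant because \<open>jA X\<close> is a cofibration out of
      a cofibrant object.\<close>
    have "cofibrant A (onObj FA X)"
      using A.M.cofibrant_of_Cof[OF jA _ X] A.j_trivial_Cof[OF X'] by blast
    note equiv = WE_iff[OF this B.fibrant_localized[OF Y] B.M.comp_hom[OF h' g], unfolded gh]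
    have "sharp X f = onArr R g \<cdot>\<^bsub>A\<^esub> sharp X (jB (onObj L X))"
      using sharp_comp_left[OF X' jB g] gj by simp
    also have "\<dots> = (onArr R g \<cdot>\<^bsub>A\<^esub> h) \<cdot>\<^bsub>A\<^esub> jA X"
      using A.M.comp_assoc[OF jA h Rg] hj unfolding adjoint_of_left_def by simp
    finally have sf: "sharp X f = (onArr R g \<cdot>\<^bsub>A\<^esub> h) \<cdot>\<^bsub>A\<^esub> jA X" .
    have "f \<in> local_equivalences B FB \<longleftrightarrow> g \<in> local_equivalences B FB"
      using B.N.WE_comp_left_iff[OF jB g] B.j_trivial_Cof[OF LX] gj by blast
    also have "\<dots> \<longleftrightarrow> g \<in> WE B" using B.local_equivalence_iff_WE[OF g W Y] .
    also have "\<dots> \<longleftrightarrow> g \<cdot>\<^bsub>B\<^esub> flat W h \<in> WE B" using B.M.WE_comp_left_iff[OF h' g hW] by simp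
    also have "\<dots> \<longleftrightarrow> onArr R g \<cdot>\<^bsub>A\<^esub> h \<in> WE A" by (rule equiv)
    also have "\<dots> \<longleftrightarrow> onArr R g \<cdot>\<^bsub>A\<^esub> h \<in> local_equivalences A FA"
      using A.local_equivalence_iff_WE[OF Rgh A.fibrant_F[OF X'] R_local[OF Y]] by simp
    also have "\<dots> \<longleftrightarrow> sharp X f \<in> local_equivalences A FA"
      using A.N.WE_comp_left_iff[OF jA Rgh] A.j_trivial_Cof[OF X'] sf by simp
    finally show ?thesis .
  qed
  \<comment> \<open>Cofibrations, cofibrant objects and the adjunction are those of the original
    structures; \<open>adjoint_of_left\<close> is unfolded to expose that composition is also the
    same.\<close>
  show ?thesis
    unfolding quillen_equivalence_def quillen_adjunction_def
    using adjunction L_Cof L_local main by (auto simp: adjoint_of_left_def)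
qed

end
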